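(* Let $T$ be a reflexive tree and let $\sigma$ be a voltage assignment on $T$ with values in $\mathbb{Z}_n$. Suppose that $(T,\sigma)$ can be odd shifting decomposed into paths $\{Q_1,\dots,Q_k\}$ whose common endpoint voltage is coprime to $n$. If $(T,\sigma)$ is properly weighted, then the covering graph $T^{\sigma}$ is Hamiltonian.
   Context: Voltage graphs and lifts: for a graph $\Gamma$ (loops allowed), each edge $[u,v]$ gives two arcs $(u,v),(v,u)$; a loop $[v,v]$ gives two arcs $(v,v)$, one called primary and one secondary. A voltage assignment is a map $\sigma$ from the arcs to a group $G$ with $\sigma(v,u)=-\sigma(u,v)$ and with the two arcs of a loop receiving inverse elements; $\sigma(v)$ denotes the value on the primary loop at $v$. The covering graph (lift) $\Gamma^\sigma$ has vertex set $V(\Gamma)\times G$, and $(u,a)$ is adjacent to $(v,b)$ iff there is an arc $(u,v)$ with $\sigma(u,v)=b-a$ (here $G=\mathbb{Z}_n$, written additively). The fiber $v^\sigma$ is the subgraph of $\Gamma^\sigma$ induced by $\{(v,g):g\in G\}$. A graph is reflexive if it has exactly one loop at every vertex. Extended billiard strategy: let $\Gamma=(v_1,\dots,v_m)$, $m\ge 2$, be a reflexive path with voltage assignment $\sigma$ into $\mathbb{Z}_n$, let $r\in\mathbb{Z}_n$, $l\in\mathbb{Z}_n$, and let $d$ be an integer with $1\le d\le n/\gcd(r,n)$. Start with paths $P_j$ ($0\le j\le d-1$) consisting of the single vertex $(v_1,l+jr)$, and set $x_j=l+jr$. For $t=1,\dots,m-1$ do: if $t=1$ put $y_j=x_j$;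 if $t\ge 2$, let $a=\sigma(v_t)$ and $X=\{x_0,\dots,x_{d-1}\}$ (the values at which the paths arrived in $v_t^\sigma$), let $s_j\ge 0$ be least with $x_j+(s_j+1)a\in X$, extend $P_j$ by the vertices $(v_t,x_j+a),\dots,(v_t,x_j+s_ja)$ and put $y_j=x_j+s_ja$. Then extend each $P_j$ by the edge from $(v_t,y_j)$ to $(v_{t+1},y_j+\sigma(v_t,v_{t+1}))$ and put $x_j:=y_j+\sigma(v_t,v_{t+1})$. The final $x_j$ is the value at which $P_j$ arrives in $v_m^\sigma$. For such $\Gamma$ define $\mathrm{c}(\Gamma)=1$ if $m=2$, and $\mathrm{c}(\Gamma)=\lceil \tfrac12\max\{\gcd(n,\sigma(v_t)):2\le t\le m-1\}\rceil$ if $m\ge 3$ (with $\gcd(n,0)=n$). Odd shifting path: $(\Gamma,\sigma)$ with $\sigma(v_1)=\sigma(v_m)=r$ (the endpoint voltage) is an odd shifting path if, with $d=2\mathrm{c}(\Gamma)\le n/\gcd(r,n)$, step $r$ and $l=0$, the family produced by the extended billiard strategy satisfies: there is an odd integer $0<s<d$ such that, writing $(a_0,\dots,a_{d-1})=(d-s,d-s+1,\dots,d-1,0,1,\dots,d-s-1)$ and $\beta=l+\sum_{t=1}^{m-1}\sigma(v_t,v_{t+1})-\sum_{t=2}^{m-1}\sigma(v_t)$, the path $P_{a_k}$ arrives in $v_m^\sigma$ at $(v_m,\beta+kr)$ for each $k=0,\dots,d-1$. (A path of $T$ is called odd shifting if, with its vertices in some order, the reflexive path formed by its vertices, edges and loops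 with the restriction of $\sigma$ is odd shifting.) Odd shifting decomposition: $T$ (with loop set $L$) can be odd shifting decomposed into $\{Q_1,\dots,Q_k\}$ if each $Q_i$ is an odd shifting path in $T$, the sets $E(Q_i)\setminus L$ partition $E(T)\setminus L$, and for $i\ne j$ every vertex common to $Q_i$ and $Q_j$ is an endpoint of both. A joint is an endpoint of some $Q_i$. For an endpoint $u$ of $Q_i$ set $\omega_{Q_i}(u)=2\mathrm{c}(Q_i)$, and for a joint $v$ let $\Omega_T(v)=\sum\omega_{Q_i}(v)$ over all $Q_i$ having $v$ as an endpoint. $(T,\sigma)$ is properly weighted if $\Omega_T(v)\le n$ for every joint $v$. *)

theory Defs
  imports Complex_Main "HOL-Algebra.Elementary_Groups" "HOL-Library.Disjoint_Sets"
begin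

section \<open>Graphs with loops\<close>

text \<open>An edge is the set of its ends, so the loop at \<open>v\<close> is the singleton \<open>{v}\<close>. Parallel edges
  and multiple loops cannot occur.\<close>

record 'v ugraph =
  verts :: "'v set"
  edges :: "'v set set"

definition finite_graph :: "'v ugraph \<Rightarrow> bool" where
  "finite_graph \<Gamma> \<longleftrightarrow> finite (verts \<Gamma>) \<and>
     (\<forall>e\<in>edges \<Gamma>. \<exists>u\<in>verts \<Gamma>. \<exists>v\<in>verts \<Gamma>. e = {u, v})"

definition loops :: "'v ugraph \<Rightarrow> 'v set set" where
  "loops \<Gamma> = {e \<in> edges \<Gamma>. \<exists>v. e = {v}}"

definition reflexive :: "'v ugraph \<Rightarrow> bool" where
  "reflexive \<Gamma> \<longleftrightarrow> (\<forall>v\<in>verts \<Gamma>. {v} \<in> edges \<Gamma>)"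

definition is_path :: "'v ugraph \<Rightarrow> 'v list \<Rightarrow> bool" where
  "is_path \<Gamma> p \<longleftrightarrow> p \<noteq> [] \<and> distinct p \<and> set p \<subseteq> verts \<Gamma> \<and>
     (\<forall>i. Suc i < length p \<longrightarrow> {p ! i, p ! Suc i} \<in> edges \<Gamma>)"

definition is_cycle :: "'v ugraph \<Rightarrow> 'v list \<Rightarrow> bool" where
  "is_cycle \<Gamma> p \<longleftrightarrow> 3 \<le> length p \<and> is_path \<Gamma> p \<and> {last p, hd p} \<in> edges \<Gamma>"

definition connected_graph :: "'v ugraph \<Rightarrow> bool" where
  "connected_graph \<Gamma> \<longleftrightarrow> verts \<Gamma> \<noteq> {} \<and>
     (\<forall>u\<in>verts \<Gamma>. \<forall>v\<in>verts \<Gamma>. \<exists>p. is_path \<Gamma> p \<and> hd p = u \<and> last p = v)"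

definition reflexive_tree :: "'v ugraph \<Rightarrow> bool" where
  "reflexive_tree \<Gamma> \<longleftrightarrow> finite_graph \<Gamma> \<and> reflexive \<Gamma> \<and> connected_graph \<Gamma> \<and> (\<nexists>p. is_cycle \<Gamma> p)"

definition hamiltonian :: "'v ugraph \<Rightarrow> bool" where
  "hamiltonian \<Gamma> \<longleftrightarrow> (\<exists>p. is_cycle \<Gamma> p \<and> set p = verts \<Gamma>)"


section \<open>Voltage assignments and lifts\<close>

datatype 'v arc = Link 'v 'v | Primary 'v | Secondary 'v

primrec arc_tail :: "'v arc \<Rightarrow> 'v" where
  "arc_tail (Link u v) = u"
| "arc_tail (Primary v) = v"
| "arc_tail (Secondary v) = v"

primrec arc_head :: "'v arc \<Rightarrow> 'v" where
  "arc_head (Link u v) = v"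
| "arc_head (Primary v) = v"
| "arc_head (Secondary v) = v"

primrec arc_rev :: "'v arc \<Rightarrow> 'v arc" where
  "arc_rev (Link u v) = Link v u"
| "arc_rev (Primary v) = Secondary v"
| "arc_rev (Secondary v) = Primary v"

definition arcs :: "'v ugraph \<Rightarrow> 'v arc set" where
  "arcs \<Gamma> = {Link u v | u v. u \<noteq> v \<and> {u, v} \<in> edges \<Gamma>}
          \<union> {Primary v | v. {v} \<in> edges \<Gamma>} \<union> {Secondary v | v. {v} \<in> edges \<Gamma>}"

definition voltage_assignment ::
    "('g, 'm) monoid_scheme \<Rightarrow> 'v ugraph \<Rightarrow> ('v arc \<Rightarrow> 'g) \<Rightarrow> bool" where
  "voltage_assignment G \<Gamma> \<sigma> \<longleftrightarrow>
     (\<forall>e\<in>arcs \<Gamma>. \<sigma> e \<in> carrier G \<and> \<sigma> (arc_rev e) = inv\<^bsub>G\<^esub> (\<sigma> e))"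

definition lift_graph ::
    "('g, 'm) monoid_scheme \<Rightarrow> 'v ugraph \<Rightarrow> ('v arc \<Rightarrow> 'g) \<Rightarrow> ('v \<times> 'g) ugraph" where
  "lift_graph G \<Gamma> \<sigma> =
     \<lparr>verts = verts \<Gamma> \<times> carrier G,
      edges = {{(u, a), (v, b)} | u v a b. a \<in> carrier G \<and> b \<in> carrier G \<and>
                 (\<exists>e\<in>arcs \<Gamma>. arc_tail e = u \<and> arc_head e = v \<and> \<sigma> e = inv\<^bsub>G\<^esub> a \<otimes>\<^bsub>G\<^esub> b)}\<rparr>"


section \<open>The extended billiard strategy\<close>

text \<open>From here on the voltage group is \<^term>\<open>integer_mod_group n\<close> with \<open>n > 0\<close>: its elements are
  the integers \<open>0, \<dots>, n - 1\<close>. The vertices \<open>v\<^sub>1, \<dots>, v\<^sub>m\<close> of a path \<open>p\<close> are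
  \<open>p ! 0, \<dots>, p ! (m - 1)\<close>, and \<open>\<sigma> (Primary v)\<close> is what is usually written \<open>\<sigma>(v)\<close>.\<close>

definition fiber_steps :: "nat \<Rightarrow> int \<Rightarrow> int set \<Rightarrow> int \<Rightarrow> nat" where
  "fiber_steps n a X x = (LEAST s. (x + int (s + 1) * a) mod int n \<in> X)"

text \<open>\<open>billiard n \<sigma> p d r l t j\<close> is the path \<open>P\<^sub>j\<close> after \<open>t\<close> rounds; its last vertex lies in the
  fiber over \<open>v\<^sub>t\<^sub>+\<^sub>1 = p ! t\<close>. The first round does not move inside the fiber over \<open>v\<^sub>1\<close>.\<close>

primrec billiard ::
    "nat \<Rightarrow> ('v arc \<Rightarrow> int) \<Rightarrow> 'v list \<Rightarrow> nat \<Rightarrow> int \<Rightarrow> int \<Rightarrow> nat \<Rightarrow> nat \<Rightarrow> ('v \<times> int) list" where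
  "billiard n \<sigma> p d r l 0 = (\<lambda>j. [(p ! 0, (l + int j * r) mod int n)])"
| "billiard n \<sigma> p d r l (Suc t) = (\<lambda>j.
     let P = billiard n \<sigma> p d r l t;
         x = (\<lambda>i. snd (last (P i)));
         X = x ` {..<d};
         v = p ! t;
         w = p ! Suc t;
         a = \<sigma> (Primary v);
         s = (if t = 0 then 0 else fiber_steps n a X (x j));
         y = x j + int s * a
     in P j @ map (\<lambda>i. (v, (x j + int i * a) mod int n)) [1..<Suc s]
            @ [(w, (y + \<sigma> (Link v w)) mod int n)])"

definition path_c :: "nat \<Rightarrow> ('v arc \<Rightarrow> int) \<Rightarrow> 'v list \<Rightarrow> nat" where
  "path_c n \<sigma> p =
     (if length p = 2 then 1
      else nat \<lceil>real_of_int (Max {gcd (int n) (\<sigma> (Primary (p ! t))) | t. 1 \<le> t \<and> t < length p - 1}) / 2\<rceil>)"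

definition path_beta :: "('v arc \<Rightarrow> int) \<Rightarrow> 'v list \<Rightarrow> int \<Rightarrow> int" where
  "path_beta \<sigma> p l = l + (\<Sum>t<length p - 1. \<sigma> (Link (p ! t) (p ! Suc t)))
                       - (\<Sum>t=1..<length p - 1. \<sigma> (Primary (p ! t)))"

text \<open>The \<open>k\<close>-th entry of \<open>(d - s, \<dots>, d - 1, 0, \<dots>, d - s - 1)\<close>.\<close>

definition shifted_index :: "nat \<Rightarrow> nat \<Rightarrow> nat \<Rightarrow> nat" where
  "shifted_index d s k = (if k < s then d - s + k else k - s)"

definition odd_shifting_sequence :: "nat \<Rightarrow> ('v arc \<Rightarrow> int) \<Rightarrow> 'v list \<Rightarrow> bool" where
  "odd_shifting_sequence n \<sigma> p \<longleftrightarrow>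
     2 \<le> length p \<and> \<sigma> (Primary (hd p)) = \<sigma> (Primary (last p)) \<and>
     (let r = \<sigma> (Primary (hd p)); d = 2 * path_c n \<sigma> p
      in int d \<le> int n div gcd r (int n) \<and>
         (\<exists>s. odd s \<and> 0 < s \<and> s < d \<and>
            (\<forall>k<d. last (billiard n \<sigma> p d r 0 (length p - 1) (shifted_index d s k))
                   = (last p, (path_beta \<sigma> p 0 + int k * r) mod int n))))"

text \<open>A path is an undirected object: it may be traversed from either end.\<close>

definition odd_shifting_path :: "nat \<Rightarrow> 'v ugraph \<Rightarrow> ('v arc \<Rightarrow> int) \<Rightarrow> 'v list \<Rightarrow> bool" where
  "odd_shifting_path n \<Gamma> \<sigma> p \<longleftrightarrow>
     is_path \<Gamma> p \<and> (odd_shifting_sequence n \<sigma> p \<or> odd_shifting_sequence n \<sigma> (rev p))"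


section \<open>Odd shifting decompositions\<close>

definition endpoints :: "'v list \<Rightarrow> 'v set" where
  "endpoints p = {hd p, last p}"

definition link_edges :: "'v list \<Rightarrow> 'v set set" where
  "link_edges p = {{p ! i, p ! Suc i} | i. Suc i < length p}"

text \<open>Disjointness is required of the family indexed by \<open>\<Q>\<close>, so a path and its reversal cannot
  both belong to \<open>\<Q>\<close>. A decomposition consists of at least one path; this only excludes the
  one-vertex tree with the empty decomposition.\<close>

definition odd_shifting_decomposition ::
    "nat \<Rightarrow> 'v ugraph \<Rightarrow> ('v arc \<Rightarrow> int) \<Rightarrow> 'v list set \<Rightarrow> bool" where
  "odd_shifting_decomposition n T \<sigma> \<Q> \<longleftrightarrow>
     finite \<Q> \<and> \<Q> \<noteq> {} \<and>
     (\<forall>Q\<in>\<Q>. odd_shifting_path n T \<sigma> Q) \<and>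
     disjoint_family_on link_edges \<Q> \<and>
     (\<Union>Q\<in>\<Q>. link_edges Q) = edges T - loops T \<and>
     (\<forall>Q\<in>\<Q>. \<forall>Q'\<in>\<Q>. Q \<noteq> Q' \<longrightarrow> set Q \<inter> set Q' \<subseteq> endpoints Q \<inter> endpoints Q')"

definition joints :: "'v list set \<Rightarrow> 'v set" where
  "joints \<Q> = (\<Union>Q\<in>\<Q>. endpoints Q)"

definition joint_weight :: "nat \<Rightarrow> ('v arc \<Rightarrow> int) \<Rightarrow> 'v list set \<Rightarrow> 'v \<Rightarrow> nat" where
  "joint_weight n \<sigma> \<Q> v = (\<Sum>Q | Q \<in> \<Q> \<and> v \<in> endpoints Q. 2 * path_c n \<sigma> Q)"

definition properly_weighted :: "nat \<Rightarrow> ('v arc \<Rightarrow> int) \<Rightarrow> 'v list set \<Rightarrow> bool" where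
  "properly_weighted n \<sigma> \<Q> \<longleftrightarrow> (\<forall>v\<in>joints \<Q>. joint_weight n \<sigma> \<Q> v \<le> n)"

end

theory Submission
  imports Defs "HOL-Library.Multiset"
begin

text \<open>
  When an odd shifting path starts in an arithmetic progression of step \<open>r\<close>, the billiard paths
  arrive in every later fiber in such a progression: leaving the fiber over \<open>v\<close>, they occupy
  the arrival values translated by \<open>- \<sigma>(v)\<close>. As \<open>r\<close> is coprime to \<open>n\<close> and
  \<open>d \<ge> gcd(n, \<sigma>(v))\<close>, such a progression meets every coset of \<open>\<langle>\<sigma>(v)\<rangle>\<close>, so the
  \<open>d\<close> disjoint paths cover all inner fibers.

  The Hamiltonian cycle grows along the tree, starting from the \<open>n\<close>-cycle of step \<open>r\<close> in the
  fiber over one joint. To attach a path \<open>Q\<close> at a joint \<open>u\<close>, take \<open>d\<close> consecutive vertices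
  \<open>x\<^sub>0, \<dots>, x\<^sub>d\<^sub>-\<^sub>1\<close> of the cycle in the fiber over \<open>u\<close> that no earlier path has used
  (the weight condition provides them), delete the edges \<open>x\<^sub>2\<^sub>ix\<^sub>2\<^sub>i\<^sub>+\<^sub>1\<close> and insert
  the billiard paths from \<open>x\<^sub>2\<^sub>i\<close> and \<open>x\<^sub>2\<^sub>i\<^sub>+\<^sub>1\<close>, joined in the fiber over the other
  end. Since the shift is odd, the arrival points that have to be joined are neighbours among the
  \<open>d\<close> arrival points; the one pair that wraps around is joined through the rest of the fiber.
\<close>

section \<open>Closed walks\<close>

text \<open>No minimum length is imposed, so that the fiber cycle from which the tour grows is
  covered also for \<open>n \<le> 2\<close>; length at least 3 is recovered only at the very
  end.\<close>

definition closed_walk :: "('a \<Rightarrow> 'a \<Rightarrow> bool) \<Rightarrow> 'a list \<Rightarrow> bool" where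
  "closed_walk E C \<longleftrightarrow> C \<noteq> [] \<and> successively E C \<and> E (last C) (hd C)"

lemma closed_walk_rotate: "closed_walk E (A @ B) \<Longrightarrow> closed_walk E (B @ A)"
  by (cases "A = []"; cases "B = []") (auto simp: closed_walk_def successively_append_iff)

lemma successively_concat_upt:
  assumes "0 < c" "\<And>i. i < c \<Longrightarrow> D i \<noteq> [] \<and> successively E (D i)"
    and "\<And>i. Suc i < c \<Longrightarrow> E (last (D i)) (hd (D (Suc i)))"
  shows "concat (map D [0..<c]) \<noteq> [] \<and> successively E (concat (map D [0..<c])) \<and>
    hd (concat (map D [0..<c])) = hd (D 0) \<and> last (concat (map D [0..<c])) = last (D (c - 1))"
  using assms
proof (induction c)
  case (Suc c)
  show ?case
  proof (cases "c = 0")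
    case True
    then show ?thesis using Suc.prems by simp
  next
    case False
    then obtain c' where c': "c = Suc c'" by (cases c) auto
    have IH: "concat (map D [0..<c]) \<noteq> [] \<and> successively E (concat (map D [0..<c])) \<and>
      hd (concat (map D [0..<c])) = hd (D 0) \<and> last (concat (map D [0..<c])) = last (D (c - 1))"
      using Suc False by auto
    have "E (last (D c')) (hd (D c))" "D c \<noteq> []" "successively E (D c)"
      using Suc.prems c' by auto
    moreover have "concat (map D [0..<Suc c]) = concat (map D [0..<c]) @ D c" by simp
    ultimately show ?thesis using IH c'
      by (metis append_is_Nil_conv diff_Suc_1 hd_append2 last_append successively_append_iff)
  qed
qed simp

text \<open>Two blocks of one word without a common entry cannot overlap, so a nonempty
  \<open>G\<close> lies inside \<open>A\<close> or inside \<open>B\<close>. Cutting out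
  \<open>F\<close> and reading on cyclically therefore leaves it in one piece. This protects the
  free stretches of the other joints when \<open>F\<close> is replaced.\<close>

lemma contiguous_after_rotation:
  assumes eq: "A @ F @ B = A' @ G @ B'" and F: "F \<noteq> []" and disj: "set F \<inter> set G = {}"
  shows "\<exists>p q. B @ A = p @ G @ q"
proof (cases "G = []")
  case False
  from eq consider us where "A = A' @ us" "us @ F @ B = G @ B'"
    | us where "A @ us = A'" "F @ B = us @ G @ B'"
    unfolding append_eq_append_conv2[of A "F @ B" A' "G @ B'"] by blast
  then show ?thesis
  proof cases
    case 1
    from 1(2) consider vs where "us = G @ vs" "vs @ F @ B = B'"
      | vs where "us @ vs = G" "F @ B = vs @ B'"
      unfolding append_eq_append_conv2[of us "F @ B" G B'] by blast
    then show ?thesis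
    proof cases
      case 1
      then have "B @ A = (B @ A') @ G @ vs" using \<open>A = A' @ us\<close> by simp
      then show ?thesis by blast
    next
      case 2
      \<comment> \<open>\<open>vs\<close> is the part of \<open>G\<close> reaching beyond
        \<open>A\<close>; if nonempty, it would start with the first entry of
        \<open>F\<close>.\<close>
      have "vs = []"
      proof (rule ccontr)
        assume "vs \<noteq> []"
        then have "hd vs = hd F" using 2(2) F by (metis hd_append2)
        then have "hd F \<in> set G" using 2(1) \<open>vs \<noteq> []\<close> by (metis UnCI hd_in_set set_append)
        then show False using F disj by (meson disjoint_iff hd_in_set)
      qed
      then have "B @ A = (B @ A') @ G @ []" using \<open>A = A' @ us\<close> 2 by simp
      then show ?thesis by blast
    qed
  next
    case 2
    from 2(2) consider ws where "F = us @ ws" "ws @ B = G @ B'"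
      | ws where "F @ ws = us" "B = ws @ G @ B'"
      unfolding append_eq_append_conv2[of F B us "G @ B'"] by blast
    then show ?thesis
    proof cases
      case 1
      have "ws = []"
      proof (rule ccontr)
        assume "ws \<noteq> []"
        then have "hd ws = hd G" using 1(2) False by (metis hd_append2)
        then have "hd G \<in> set F" using 1(1) \<open>ws \<noteq> []\<close> by (metis UnCI hd_in_set set_append)
        then show False using False disj by (meson disjoint_iff hd_in_set)
      qed
      then have "B @ A = [] @ G @ (B' @ A)" using 1 by simp
      then show ?thesis by blast
    next
      case 2
      then have "B @ A = ws @ G @ (B' @ A)" by simp
      then show ?thesis by blast
    qed
  qed
qed auto

section \<open>Reachability and simple paths\<close>

lemma rtranclp_imp_path:
  assumes "R\<^sup>*\<^sup>* a b"
  shows "\<exists>p. p \<noteq> [] \<and> distinct p \<and> successively R p \<and> hd p = a \<and> last p = b"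
  using assms
proof (induction rule: rtranclp_induct)
  case base
  show ?case by (rule exI[of _ "[a]"]) simp
next
  case (step b c)
  then obtain p where p: "p \<noteq> []" "distinct p" "successively R p" "hd p = a" "last p = b" by auto
  show ?case
  proof (cases "c \<in> set p")
    case True
    then obtain q q' where q: "p = q @ c # q'" by (meson split_list)
    show ?thesis
      by (rule exI[of _ "q @ [c]"]) (use p q in \<open>auto simp: successively_append_iff hd_append\<close>)
  next
    case False
    then show ?thesis
      by (intro exI[of _ "p @ [c]"]) (use p step in \<open>auto simp: successively_append_iff\<close>)
  qed
qed

lemma successively_imp_rtranclp_hd:
  "successively R p \<Longrightarrow> x \<in> set p \<Longrightarrow> R\<^sup>*\<^sup>* (hd p) x"
proof (induction p)
  case (Cons a p)
  show ?case
  proof (cases "x = a")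
    case False
    then have "x \<in> set p" "p \<noteq> []" using Cons.prems by auto
    then have "R a (hd p)" "R\<^sup>*\<^sup>* (hd p) x" using Cons by (auto simp: successively_Cons)
    then show ?thesis by (simp add: converse_rtranclp_into_rtranclp)
  qed simp
qed simp

lemma successively_imp_rtranclp:
  assumes "symp R" "successively R p" "x \<in> set p" "y \<in> set p"
  shows "R\<^sup>*\<^sup>* x y"
proof -
  have "R\<^sup>*\<^sup>* x (hd p)"
    using successively_imp_rtranclp_hd[OF assms(2,3)] assms(1)
    by (blast dest: sympD[OF symp_rtranclp])
  then show ?thesis using successively_imp_rtranclp_hd[OF assms(2,4)] by simp
qed

lemma successively_crossing:
  "successively R p \<Longrightarrow> p \<noteq> [] \<Longrightarrow> hd p \<in> W \<Longrightarrow> last p \<notin> W \<Longrightarrow> \<exists>a b. R a b \<and> a \<in> W \<and> b \<notin> W"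
  by (induction p) (auto simp: successively_Cons split: if_splits)

section \<open>Weaving a bundle of paths into a closed walk\<close>

lemma sum_pairs: "(\<Sum>j<2 * c. f j) = (\<Sum>i<c. f (2 * i) + f (Suc (2 * i)) :: 'a :: comm_monoid_add)" for c :: nat
  by (induction c) (auto simp: algebra_simps)

lemma mset_concat_map_upt: "mset (concat (map D [0..<c])) = (\<Sum>i<c. mset (D i))"
  by (induction c) auto

text \<open>Block \<open>D i\<close> goes out along \<open>R (2 * i)\<close> and back along
  \<open>R (Suc (2 * i))\<close>; the two arrival positions are cyclic neighbours modulo
  \<open>d\<close>. Since \<open>s\<close> is odd and \<open>d\<close> even, the wrap from
  \<open>d - 1\<close> to 0 falls inside one such pair and not between two pairs, so the rest of the
  \<open>y\<close>-cycle can be inserted there. The conclusion keeps that rest and \<open>M\<close>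
  as contiguous blocks because later attachments need room in them; the multiset equation yields
  distinctness and vertex set together.\<close>

lemma weave_bundle:
  fixes R :: "nat \<Rightarrow> 'a list"
  assumes sym: "symp E" and d: "d = 2 * c" "0 < c" "d \<le> n" and s: "odd s" "s < d"
    and cyc: "closed_walk E (map x [0..<d] @ M)"
    and R: "\<And>j. j < d \<Longrightarrow> R j \<noteq> [] \<and> successively E (R j) \<and> hd (R j) = x j \<and> last (R j) = y ((j + s) mod d)"
    and y: "successively E (map y [0..<n])" "E (y (n - 1)) (y 0)"
  shows "\<exists>A B. closed_walk E (A @ map y [d..<n] @ B @ M) \<and>
     mset (A @ map y [d..<n] @ B @ M) = (\<Sum>j<d. mset (R j)) + mset (map y [d..<n]) + mset M"
proof -
  \<comment> \<open>the only even index whose path arrives at \<open>y (d - 1)\<close>, from where the walk takes the long way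
    through \<open>N\<close> back to \<open>y 0\<close>\<close>
  define i0 where "i0 = (d - 1 - s) div 2"
  define N where "N = map y [d..<n]"
  define D where "D i = R (2 * i) @ (if i = i0 then N else []) @ rev (R (Suc (2 * i)))" for i
  define K where "K = concat (map D [0..<c])"
  have i0: "2 * i0 + s = d - 1" "i0 < c" using s d unfolding i0_def by (auto elim!: oddE)
  have ystep: "E (y k) (y (Suc k))" if "Suc k < n" for k
    using successively_nth[OF y(1), of k] that by simp
  have xs: "successively E (map x [0..<d])" "successively E M"
    using cyc by (auto simp: closed_walk_def successively_append_iff)
  have xstep: "E (x k) (x (Suc k))" if "Suc k < d" for k
    using successively_nth[OF xs(1), of k] that by simp
  have symE: "E a b \<Longrightarrow> E b a" for a b using sym by (rule sympD)
  have succ_rev: "successively E (rev p) \<longleftrightarrow> successively E p" for p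
    unfolding successively_rev by (auto elim!: successively_mono intro: symE)
  have D: "D i \<noteq> [] \<and> successively E (D i) \<and> hd (D i) = x (2 * i) \<and> last (D i) = x (Suc (2 * i))"
    if "i < c" for i
  proof -
    have lt: "2 * i < d" "Suc (2 * i) < d" using that d by auto
    note Ri = R[OF lt(1)] R[OF lt(2)]
    show ?thesis
    proof (cases "i = i0")
      case True
      have e: "(2 * i + s) mod d = d - 1" "(Suc (2 * i) + s) mod d = 0"
        using i0 True d by auto
      \<comment> \<open>If \<open>d = n\<close>, nothing of the \<open>y\<close>-cycle is left over
        and its closing edge from \<open>y (n - 1)\<close> to \<open>y 0\<close> joins the pair;
        otherwise the detour through \<open>N\<close> ends with that edge.\<close>
      show ?thesis
      proof (cases "d = n")
        case eqn: True
        then have "N = []" by (simp add: N_def)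
        then show ?thesis using Ri e y(2) eqn
          by (auto simp: D_def successively_append_iff hd_rev last_rev succ_rev simp del: successively_rev)
      next
        case neq: False
        then have "d < n" using d by simp
        then have N: "N \<noteq> []" "hd N = y d" "last N = y (n - 1)"
          by (auto simp: N_def hd_map last_map)
        have "map y [0..<n] = map y [0..<d] @ N"
          using d upt_add_eq_append[of 0 d "n - d"] unfolding N_def by (metis le_add_diff_inverse map_append zero_le)
        then have "successively E N" using y(1) by (simp add: successively_append_iff)
        moreover have "E (y (d - 1)) (y d)" using ystep[of "d - 1"] \<open>d < n\<close> d by simp
        ultimately show ?thesis using Ri e y(2) True N
          by (auto simp: D_def successively_append_iff hd_rev last_rev succ_rev simp del: successively_rev)
      qed
    next
      case False
      have ne: "2 * i + s \<noteq> d - 1" using False i0 by auto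
      \<comment> \<open>Only \<open>d - 1\<close> itself could give this residue, the next candidate
        \<open>2 * d - 1\<close> being out of range.\<close>
      have "(2 * i + s) mod d \<noteq> d - 1"
      proof
        assume a: "(2 * i + s) mod d = d - 1"
        have "2 * i + s < 2 * d - 1" using that s d by auto
        show False
        proof (cases "2 * i + s < d")
          case True then show False using a ne by simp
        next
          case False
          then have "(2 * i + s) mod d = 2 * i + s - d" using \<open>2 * i + s < 2 * d - 1\<close> by (simp add: le_mod_geq)
          then show False using a \<open>2 * i + s < 2 * d - 1\<close> d by simp
        qed
      qed
      moreover have "(2 * i + s) mod d < d" using d by simp
      ultimately have lt': "Suc ((2 * i + s) mod d) < d" by simp
      then have e: "(Suc (2 * i) + s) mod d = Suc ((2 * i + s) mod d)"
        by (simp add: mod_Suc)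
      have "E (y ((2 * i + s) mod d)) (y (Suc ((2 * i + s) mod d)))"
        by (rule ystep) (use lt' d in simp)
      then show ?thesis using Ri e False
        by (auto simp: D_def successively_append_iff hd_rev last_rev succ_rev simp del: successively_rev)
    qed
  qed
  have K: "K \<noteq> [] \<and> successively E K \<and> hd K = hd (D 0) \<and> last K = last (D (c - 1))"
    unfolding K_def
  proof (rule successively_concat_upt)
    fix i assume "Suc i < c"
    then show "E (last (D i)) (hd (D (Suc i)))"
      using D[of i] D[of "Suc i"] xstep[of "Suc (2 * i)"] d by simp
  qed (use D d in auto)
  have hdK: "hd K = x 0" "last K = x (d - 1)"
  proof -
    have "Suc (2 * (c - 1)) = d - 1" using d by auto
    then show "hd K = x 0" "last K = x (d - 1)" using K D[of 0] D[of "c - 1"] d by auto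
  qed
  have upt: "[0..<d] \<noteq> []" "hd [0..<d] = 0" "last [0..<d] = d - 1" using d by auto
  have "closed_walk E (K @ M)"
    using cyc K hdK upt by (cases "M = []") (auto simp: closed_walk_def successively_append_iff hd_map last_map)
  moreover have "[0..<c] = [0..<i0] @ i0 # [Suc i0..<c]"
    using i0 by (metis less_imp_le_nat upt_add_eq_append upt_conv_Cons le_add_diff_inverse zero_le)
  then have "K = (concat (map D [0..<i0]) @ R (2 * i0)) @ N @ (rev (R (Suc (2 * i0))) @ concat (map D [Suc i0..<c]))"
    by (simp add: K_def D_def)
  moreover have "mset (K @ M) = (\<Sum>j<d. mset (R j)) + mset N + mset M"
  proof -
    have "mset K = (\<Sum>i<c. (mset (R (2 * i)) + mset (R (Suc (2 * i)))) + (if i = i0 then mset N else {#}))"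
      unfolding K_def mset_concat_map_upt by (intro sum.cong) (auto simp: D_def)
    also have "\<dots> = (\<Sum>j<d. mset (R j)) + mset N"
      using i0 by (simp add: sum.distrib d sum_pairs)
    finally show ?thesis by simp
  qed
  ultimately show ?thesis unfolding N_def by (metis append_assoc)
qed

section \<open>The billiard strategy in a fiber\<close>

text \<open>Guarantees that the \<open>LEAST\<close> in \<open>fiber_steps\<close> is attained:
  after \<open>n\<close> steps of size \<open>a\<close> the walk is back at \<open>x\<close>, so
  \<open>n - 1\<close> is a candidate.\<close>

lemma fiber_steps_return:
  assumes "0 < n" "X \<subseteq> {0..<int n}" "x \<in> X"
  shows "(x + int (fiber_steps n a X x + 1) * a) mod int n \<in> X"
proof -
  have "(x + int ((n - 1) + 1) * a) mod int n = x"
    using assms by (auto simp: mod_pos_pos_trivial)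
  then have "(x + int ((n - 1) + 1) * a) mod int n \<in> X" using assms by simp
  then show ?thesis unfolding fiber_steps_def by (rule LeastI)
qed

lemma fiber_steps_avoid:
  assumes "0 < i" "i \<le> fiber_steps n a X x"
  shows "(x + int i * a) mod int n \<notin> X"
proof -
  have "i - 1 < fiber_steps n a X x" using assms by simp
  from not_less_Least[OF this[unfolded fiber_steps_def]] show ?thesis using assms by simp
qed

text \<open>If two stretches met, dropping the smaller number of steps from both would make one of
  them hit the starting point of the other, an element of \<open>X\<close>, within its own length;
  \<open>fiber_steps_avoid\<close> then leaves only zero steps.\<close>

lemma fiber_steps_disjoint:
  assumes X: "X \<subseteq> {0..<int n}" "x \<in> X" "x' \<in> X"
    and i: "i \<le> fiber_steps n a X x" "i' \<le> fiber_steps n a X x'"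
    and eq: "(x + int i * a) mod int n = (x' + int i' * a) mod int n"
  shows "x = x' \<and> i = i'"
proof -
  have main: "u = u' \<and> k = k'"
    if "u \<in> X" "u' \<in> X" "k \<le> fiber_steps n a X u" "k' \<le> k"
      "(u + int k * a) mod int n = (u' + int k' * a) mod int n" for u u' k k'
  proof -
    have "(u + int k * a - int k' * a) mod int n = (u' + int k' * a - int k' * a) mod int n"
      using that(5) by (metis mod_diff_cong)
    then have e: "(u + int (k - k') * a) mod int n = u' mod int n"
      using that(4) by (simp add: of_nat_diff algebra_simps)
    moreover have "u' mod int n = u'" using that(2) X(1) by auto
    ultimately have "(u + int (k - k') * a) mod int n \<in> X" using that(2) by simp
    then have "k - k' = 0"
      using fiber_steps_avoid[of "k - k'" n a X u] that(3) by (meson diff_le_self gr0I le_trans)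
    moreover have "u mod int n = u" using that(1) X(1) by auto
    ultimately show ?thesis using e \<open>u' mod int n = u'\<close> that(4) by simp
  qed
  show ?thesis
  proof (cases "i' \<le> i")
    case True
    then show ?thesis using main[of x x' i i'] assms by simp
  next
    case False
    then show ?thesis using main[of x' x i' i] assms by simp
  qed
qed

text \<open>Along the steps of size \<open>a\<close> from \<open>x\<close>, each time a stretch is
  exhausted the next step lands in \<open>X\<close> again and a new stretch begins; hence the
  induction on the number of steps.\<close>

lemma fiber_steps_cover:
  assumes n: "0 < n" and X: "X \<subseteq> {0..<int n}" "x \<in> X" and z: "(x + int i * a) mod int n = z"
  shows "\<exists>x\<in>X. \<exists>i\<le>fiber_steps n a X x. (x + int i * a) mod int n = z"
  using X(2) z
proof (induction i arbitrary: x rule: less_induct)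
  case (less i)
  let ?s = "fiber_steps n a X x"
  show ?case
  proof (cases "i \<le> ?s")
    case False
    define x' where "x' = (x + int (?s + 1) * a) mod int n"
    have "x' \<in> X" unfolding x'_def by (rule fiber_steps_return[OF n X(1) less.prems(1)])
    have "(x' + int (i - (?s + 1)) * a) mod int n = (x + int (?s + 1) * a + int (i - (?s + 1)) * a) mod int n"
      unfolding x'_def by (rule mod_add_left_eq)
    also have "\<dots> = (x + int i * a) mod int n"
      using False by (simp add: of_nat_diff algebra_simps)
    finally have "(x' + int (i - (?s + 1)) * a) mod int n = z" using less.prems by simp
    moreover have "i - (?s + 1) < i" using False by simp
    ultimately show ?thesis using less.IH \<open>x' \<in> X\<close> by blast
  qed (use less.prems in blast)
qed

text \<open>One step after its exit point a stretch returns to \<open>X\<close>. As stretches are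
  disjoint, this return map \<open>f\<close> is injective on the finite set \<open>X\<close>, hence
  a permutation of it, and stepping back by \<open>a\<close> gives all exit points.\<close>

lemma fiber_steps_exit:
  assumes n: "0 < n" and X: "X \<subseteq> {0..<int n}"
  shows "(\<lambda>x. (x + int (fiber_steps n a X x) * a) mod int n) ` X = (\<lambda>x. (x - a) mod int n) ` X"
proof -
  define f where "f x = (x + int (fiber_steps n a X x + 1) * a) mod int n" for x
  have f_minus: "(f x - a) mod int n = (x + int (fiber_steps n a X x) * a) mod int n" for x
    unfolding f_def by (simp add: mod_simps algebra_simps)
  have "inj_on f X"
  proof (rule inj_onI)
    fix x y assume "x \<in> X" "y \<in> X" "f x = f y"
    then have "(x + int (fiber_steps n a X x) * a) mod int n = (y + int (fiber_steps n a X y) * a) mod int n"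
      by (metis f_minus)
    then show "x = y" using fiber_steps_disjoint[OF X \<open>x \<in> X\<close> \<open>y \<in> X\<close>] by blast
  qed
  moreover have "f ` X \<subseteq> X" using fiber_steps_return[OF n X] by (auto simp: f_def)
  moreover have "finite X" using X finite_subset by blast
  ultimately have fX: "f ` X = X" by (simp add: endo_inj_surj)
  have "(\<lambda>x. (x - a) mod int n) ` (f ` X) = (\<lambda>x. (f x - a) mod int n) ` X" by (rule image_image)
  then show ?thesis unfolding fX f_minus by (rule sym)
qed

text \<open>Steps of size \<open>a\<close> reach a whole residue class modulo
  \<open>g = gcd (int n) a\<close>, and \<open>r\<close> is a unit modulo \<open>g\<close> because
  it is coprime to \<open>n\<close>; so \<open>g\<close> consecutive terms of the progression
  already represent all classes.\<close>

lemma progression_meets_all_cosets: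
  fixes r a z b :: int
  assumes n: "0 < n" and r: "coprime r (int n)" and d: "gcd (int n) a \<le> int d" and z: "0 \<le> z" "z < int n"
  shows "\<exists>k<d. \<exists>i. ((b + int k * r) mod int n + int i * a) mod int n = z"
proof -
  define g where "g = gcd (int n) a"
  have g: "0 < g" "g dvd int n" using n by (auto simp: g_def)
  have "coprime r g" using r g(2) by (meson coprime_divisors dvd_refl)
  then obtain u v where uv: "u * r + v * g = 1" using bezout_int[of r g] by auto
  \<comment> \<open>\<open>u\<close> inverts \<open>r\<close> modulo \<open>g\<close>, so this
    \<open>k\<close> solves \<open>b + k * r = z\<close> modulo \<open>g\<close>.\<close>
  define k where "k = nat (((z - b) * u) mod g)"
  have k: "int k = ((z - b) * u) mod g" using g by (simp add: k_def)
  have "k < d" using g d k by (metis g_def less_le_trans of_nat_less_iff pos_mod_bound)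
  have "g dvd (z - b) * u - int k" unfolding k by (simp add: minus_mod_eq_mult_div)
  then have "g dvd ((z - b) * u - int k) * r + (z - b) * v * g" by simp
  also have "((z - b) * u - int k) * r + (z - b) * v * g = (z - b) * (u * r + v * g) - int k * r"
    by (simp add: algebra_simps)
  finally have "g dvd z - b - int k * r" by (simp add: uv)
  then obtain q where q: "z - b - int k * r = g * q" by blast
  obtain u' v' where uv': "u' * int n + v' * a = g" unfolding g_def using bezout_int by blast
  \<comment> \<open>By Bezout, \<open>v' * a\<close> is \<open>g\<close> modulo \<open>n\<close>, so
    \<open>q * v'\<close> steps of size \<open>a\<close> cover the remaining difference
    \<open>g * q\<close>; reduction modulo \<open>n\<close> makes their number nonnegative.\<close>
  define i where "i = nat ((q * v') mod int n)"
  have i: "int i = (q * v') mod int n" using n by (simp add: i_def)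
  have "((b + int k * r) mod int n + int i * a) mod int n = (b + int k * r + q * v' * a) mod int n"
    unfolding i by (metis mod_add_cong mod_mod_trivial mod_mult_left_eq)
  also have "b + int k * r + q * v' * a = z + (- (q * u')) * int n"
    using arg_cong[OF uv', of "\<lambda>t. t * q"] q by (simp add: algebra_simps)
  also have "(z + (- (q * u')) * int n) mod int n = z" unfolding mod_mult_self1 using z by simp
  finally show ?thesis using \<open>k < d\<close> by blast
qed

text \<open>Only the set \<open>X\<close> of arrival values is recorded, not which path arrives
  where: covering and disjointness depend on the set alone, and the order enters later through the
  odd shift.\<close>

definition path_family ::
    "('v \<times> int \<Rightarrow> 'v \<times> int \<Rightarrow> bool) \<Rightarrow> nat \<Rightarrow> (nat \<Rightarrow> 'v \<times> int) \<Rightarrow> (nat \<Rightarrow> ('v \<times> int) list)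
      \<Rightarrow> 'v \<Rightarrow> int set \<Rightarrow> ('v \<times> int) set \<Rightarrow> bool" where
  "path_family E d h F v X U \<longleftrightarrow>
     (\<forall>j<d. F j \<noteq> [] \<and> hd (F j) = h j \<and> distinct (F j) \<and> successively E (F j) \<and> fst (last (F j)) = v) \<and>
     (\<forall>i<d. \<forall>j<d. i \<noteq> j \<longrightarrow> set (F i) \<inter> set (F j) = {}) \<and>
     (\<Union>j<d. set (F j)) = U \<and> (\<lambda>j. snd (last (F j))) ` {..<d} = X"

lemma path_family_inj:
  assumes "path_family E d h F v X U" "i < d" "j < d" "snd (last (F i)) = snd (last (F j))"
  shows "i = j"
proof (rule ccontr)
  assume "i \<noteq> j"
  then have "set (F i) \<inter> set (F j) = {}" "last (F i) = last (F j)" "F i \<noteq> []" "F j \<noteq> []"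
    using assms by (auto simp: path_family_def prod_eq_iff)
  then show False by (metis disjoint_iff last_in_set)
qed

text \<open>The conditions concern \<open>last (F j) # G j\<close> so that empty extensions, which
  occur when a path leaves a fiber at its arrival point, obey the same formula.\<close>

lemma path_family_append:
  assumes fam: "path_family E d h F v X U"
    and G: "\<And>j. j < d \<Longrightarrow> distinct (G j) \<and> successively E (last (F j) # G j)
      \<and> fst (last (last (F j) # G j)) = w \<and> snd (last (last (F j) # G j)) = y j \<and> set (G j) \<inter> U = {}"
    and disj: "\<And>i j. i < d \<Longrightarrow> j < d \<Longrightarrow> i \<noteq> j \<Longrightarrow> set (G i) \<inter> set (G j) = {}"
  shows "path_family E d h (\<lambda>j. F j @ G j) w (y ` {..<d}) (U \<union> (\<Union>j<d. set (G j)))"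
proof -
  have sub: "set (F j) \<subseteq> U" if "j < d" for j using fam that by (auto simp: path_family_def)
  have last: "last (F j @ G j) = last (last (F j) # G j)" if "j < d" for j
    using that fam by (auto simp: path_family_def)
  have "successively E (F j @ G j)" if "j < d" for j
    using that fam G[OF that] by (auto simp: path_family_def successively_append_iff successively_Cons)
  moreover have "distinct (F j @ G j)" if "j < d" for j
    using that fam G[OF that] sub[OF that] by (auto simp: path_family_def)
  moreover have "set (F i @ G i) \<inter> set (F j @ G j) = {}" if "i < d" "j < d" "i \<noteq> j" for i j
  proof -
    have "set (F i) \<inter> set (F j) = {}" using fam that by (auto simp: path_family_def)
    moreover have "set (F i) \<inter> set (G j) = {}" "set (G i) \<inter> set (F j) = {}"
      using G[OF that(1)] G[OF that(2)] sub[OF that(1)] sub[OF that(2)] by blast+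
    ultimately show ?thesis using disj[OF that] by auto
  qed
  moreover have "(\<lambda>j. snd (last (F j @ G j))) ` {..<d} = y ` {..<d}"
    using G last by (intro image_cong) auto
  moreover have "(\<Union>j<d. set (F j @ G j)) = U \<union> (\<Union>j<d. set (G j))"
    using fam by (auto simp: path_family_def)
  moreover have "F j @ G j \<noteq> [] \<and> hd (F j @ G j) = h j" if "j < d" for j
    using that fam by (auto simp: path_family_def)
  moreover have "fst (last (F j @ G j)) = w" if "j < d" for j using that G last by simp
  ultimately show ?thesis unfolding path_family_def by presburger
qed

section \<open>Progressions and path families in the lift\<close>

locale coprime_lift =
  fixes n :: nat and T :: "'v ugraph" and \<sigma> :: "'v arc \<Rightarrow> int" and r :: int
  assumes n: "0 < n" and reflexive: "reflexive T"
    and voltage: "voltage_assignment (integer_mod_group n) T \<sigma>"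
    and coprime: "coprime r (int n)"
begin

abbreviation Z :: "int set" where "Z \<equiv> {0..<int n}"

abbreviation adj :: "'v \<times> int \<Rightarrow> 'v \<times> int \<Rightarrow> bool" where
  "adj x y \<equiv> {x, y} \<in> edges (lift_graph (integer_mod_group n) T \<sigma>)"

definition progression :: "int \<Rightarrow> nat \<Rightarrow> int set" where
  "progression b d = (\<lambda>k. (b + int k * r) mod int n) ` {..<d}"

lemma symp_adj: "symp adj"
  by (auto intro!: sympI simp: insert_commute)

lemma mod_in_Z [simp]: "x mod int n \<in> Z"
  using n by simp

lemma progression_subset: "progression b d \<subseteq> Z"
  using n by (auto simp: progression_def)

lemma progression_shift: "(\<lambda>x. (x + c) mod int n) ` progression b d = progression (b + c) d"
  unfolding progression_def image_image by (intro image_cong) (auto simp: mod_simps algebra_simps)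

lemma progression_inj:
  assumes "i < n" "j < n" "(b + int i * r) mod int n = (b + int j * r) mod int n"
  shows "i = j"
proof -
  have "int n dvd (b + int i * r) - (b + int j * r)" using assms(3) mod_eq_dvd_iff by blast
  then have "int n dvd (int i - int j) * r" by (simp add: algebra_simps)
  then have "int n dvd int i - int j" using coprime by (simp add: coprime_commute coprime_dvd_mult_left_iff)
  moreover have "\<bar>int i - int j\<bar> < int n" using assms by auto
  ultimately have "int i - int j = 0" using dvd_imp_le_int[of "int i - int j" "int n"] by linarith
  then show ?thesis by simp
qed

lemma progression_full: "progression b n = Z"
proof (rule card_subset_eq)
  have "inj_on (\<lambda>k. (b + int k * r) mod int n) {..<n}" by (auto intro!: inj_onI dest: progression_inj)
  then show "card (progression b n) = card Z" by (simp add: progression_def card_image)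
qed (use progression_subset in auto)

lemma adj_arc:
  assumes "e \<in> arcs T" "x \<in> Z"
  shows "adj (arc_tail e, x) (arc_head e, (x + \<sigma> e) mod int n)"
proof -
  let ?G = "integer_mod_group n"
  have C: "carrier ?G = Z" using n by (simp add: carrier_integer_mod_group)
  have "\<sigma> e \<in> Z" using assms(1) voltage C by (auto simp: voltage_assignment_def)
  then have "\<sigma> e = inv\<^bsub>?G\<^esub> x \<otimes>\<^bsub>?G\<^esub> ((x + \<sigma> e) mod int n)"
    using assms(2) C by (simp add: mod_simps)
  moreover have "(x + \<sigma> e) mod int n \<in> carrier ?G" "x \<in> carrier ?G"
    using assms(2) C mod_in_Z by auto
  ultimately show ?thesis unfolding lift_graph_def using assms(1)
    by (auto simp del: inv_integer_mod_group mult_integer_mod_group) blast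
qed

lemma adj_loop:
  assumes "v \<in> verts T" "x \<in> Z"
  shows "adj (v, x) (v, (x + \<sigma> (Primary v)) mod int n)"
  using adj_arc[of "Primary v" x] assms reflexive by (auto simp: arcs_def reflexive_def)

lemma adj_link:
  assumes "{u, v} \<in> edges T" "u \<noteq> v" "x \<in> Z"
  shows "adj (u, x) (v, (x + \<sigma> (Link u v)) mod int n)"
  using adj_arc[of "Link u v" x] assms by (auto simp: arcs_def)

text \<open>The stretches are disjoint by \<open>fiber_steps_disjoint\<close>, they end in the
  translated arrival set by \<open>fiber_steps_exit\<close>, and they exhaust the fiber because the
  arrival set meets every coset and \<open>fiber_steps_cover\<close> applies in each.\<close>

lemma path_family_fiber:
  assumes fam: "path_family adj d h F v (progression b d) U" and v: "v \<in> verts T"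
    and U: "\<And>x. (v, x) \<in> U \<longleftrightarrow> x \<in> progression b d"
    and d: "gcd (int n) (\<sigma> (Primary v)) \<le> int d"
    and G: "\<And>j. s j = fiber_steps n (\<sigma> (Primary v)) (progression b d) (snd (last (F j)))"
  shows "path_family adj d h
     (\<lambda>j. F j @ map (\<lambda>i. (v, (snd (last (F j)) + int i * \<sigma> (Primary v)) mod int n)) [1..<Suc (s j)])
     v (progression (b - \<sigma> (Primary v)) d) (U \<union> {v} \<times> Z)"
proof -
  define a where "a = \<sigma> (Primary v)"
  define x where "x j = snd (last (F j))" for j
  define X where "X = progression b d"
  define G where "G j = map (\<lambda>i. (v, (x j + int i * a) mod int n)) [1..<Suc (s j)]" for j
  have X: "X \<subseteq> Z" unfolding X_def by (rule progression_subset)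
  have xX: "x j \<in> X" if "j < d" for j using fam that by (auto simp: path_family_def x_def X_def)
  have xim: "x ` {..<d} = X" using fam by (auto simp: path_family_def x_def X_def)
  have sj: "s j = fiber_steps n a X (x j)" for j using assms(5) by (simp add: a_def X_def x_def)
  have lF: "last (F j) = (v, x j)" if "j < d" for j
    using fam that by (auto simp: path_family_def x_def prod_eq_iff)
  have xmod: "x j mod int n = x j" if "j < d" for j using xX[OF that] X by auto
  \<comment> \<open>With the arrival vertex in front as index 0, the stretch becomes a plain map
    over \<open>0, ..., s j\<close>.\<close>
  have full: "last (F j) # G j = map (\<lambda>i. (v, (x j + int i * a) mod int n)) [0..<Suc (s j)]"
    if "j < d" for j
    using lF[OF that] xmod[OF that] unfolding G_def
    by (subst upt_conv_Cons[of 0]) auto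
  have setG: "set (G j) = (\<lambda>i. (v, (x j + int i * a) mod int n)) ` {1..s j}" for j
    unfolding G_def set_map set_upt atLeastLessThanSuc_atLeastAtMost ..
  have disj: "i = i' \<and> j = j'"
    if "j < d" "j' < d" "i \<le> s j" "i' \<le> s j'" "(x j + int i * a) mod int n = (x j' + int i' * a) mod int n"
    for i i' j j'
  proof -
    have "x j = x j' \<and> i = i'"
      by (rule fiber_steps_disjoint[OF X xX xX]) (use that sj in auto)
    then show ?thesis using path_family_inj[OF fam that(1,2)] by (simp add: x_def)
  qed
  have step: "adj (v, (x j + int i * a) mod int n) (v, (x j + int (Suc i) * a) mod int n)" for i j
    using adj_loop[OF v mod_in_Z, of "x j + int i * a"] by (simp add: a_def mod_simps algebra_simps)
  have "path_family adj d h (\<lambda>j. F j @ G j) v ((\<lambda>j. (x j + int (s j) * a) mod int n) ` {..<d})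
    (U \<union> (\<Union>j<d. set (G j)))"
  proof (rule path_family_append[OF fam])
    fix j assume j: "j < d"
    have "distinct (G j)" unfolding G_def distinct_map
      using disj[OF j j] by (auto intro!: inj_onI simp del: upt_Suc)
    moreover have "successively adj (last (F j) # G j)"
      unfolding full[OF j] successively_conv_nth using step by (auto simp del: upt_Suc)
    moreover have "last (last (F j) # G j) = (v, (x j + int (s j) * a) mod int n)"
      unfolding full[OF j] by simp
    moreover have "set (G j) \<inter> U = {}"
      using U fiber_steps_avoid[of _ n a X "x j"] sj by (auto simp: setG X_def)
    ultimately show "distinct (G j) \<and> successively adj (last (F j) # G j)
      \<and> fst (last (last (F j) # G j)) = v \<and> snd (last (last (F j) # G j)) = (x j + int (s j) * a) mod int n
      \<and> set (G j) \<inter> U = {}" by simp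
  next
    fix i j assume "i < d" "j < d" "i \<noteq> j"
    then show "set (G i) \<inter> set (G j) = {}" using disj[of i j] by (fastforce simp: setG)
  qed
  moreover have "(\<lambda>j. (x j + int (s j) * a) mod int n) ` {..<d} = progression (b - a) d"
  proof -
    have "(\<lambda>j. (x j + int (s j) * a) mod int n) ` {..<d}
      = (\<lambda>x. (x + int (fiber_steps n a X x) * a) mod int n) ` X"
      unfolding sj xim[symmetric] image_image ..
    also have "\<dots> = (\<lambda>x. (x + - a) mod int n) ` X"
      using fiber_steps_exit[OF n X, of a] by simp
    finally show ?thesis unfolding X_def progression_shift by simp
  qed
  moreover have "U \<union> (\<Union>j<d. set (G j)) = U \<union> {v} \<times> Z"
  proof -
    have "(v, z) \<in> U \<union> (\<Union>j<d. set (G j))" if z: "z \<in> Z" for z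
    proof -
      obtain k i where "k < d" "((b + int k * r) mod int n + int i * a) mod int n = z"
        using progression_meets_all_cosets[OF n coprime d, of z b] z by (auto simp: a_def)
      moreover have "(b + int k * r) mod int n \<in> X"
        using \<open>k < d\<close> by (auto simp: X_def progression_def)
      ultimately obtain y i where y: "y \<in> X" "i \<le> fiber_steps n a X y" "(y + int i * a) mod int n = z"
        using fiber_steps_cover[OF n X] by blast
      then obtain j where j: "j < d" "y = x j" using xim by auto
      \<comment> \<open>Index 0 is the arrival point itself, which belongs to \<open>U\<close> and
        not to \<open>G j\<close>.\<close>
      show ?thesis
      proof (cases "i = 0")
        case True
        then have "z = x j" using y j xmod by simp
        then have "(v, z) \<in> U" using U xX[OF j(1)] by (simp add: X_def)
        then show ?thesis ..
      next
        case False
        then have "(v, z) \<in> set (G j)" using y j sj by (auto simp: setG)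
        then show ?thesis using j by blast
      qed
    qed
    moreover have "set (G j) \<subseteq> {v} \<times> Z" for j using n by (auto simp: setG)
    ultimately show ?thesis by blast
  qed
  ultimately show ?thesis unfolding G_def x_def a_def by simp
qed

lemma path_family_link:
  assumes fam: "path_family adj d h F v (progression b d) U" and e: "{v, w} \<in> edges T" "v \<noteq> w"
    and w: "\<And>x. (w, x) \<notin> U"
  shows "path_family adj d h (\<lambda>j. F j @ [(w, (snd (last (F j)) + \<sigma> (Link v w)) mod int n)])
     w (progression (b + \<sigma> (Link v w)) d) (U \<union> {w} \<times> progression (b + \<sigma> (Link v w)) d)"
proof -
  define c where "c = \<sigma> (Link v w)"
  define x where "x j = snd (last (F j))" for j
  have xim: "x ` {..<d} = progression b d" using fam by (auto simp: path_family_def x_def)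
  then have xZ: "x j \<in> Z" if "j < d" for j using progression_subset that by blast
  have lF: "last (F j) = (v, x j)" if "j < d" for j
    using fam that by (auto simp: path_family_def x_def prod_eq_iff)
  have "path_family adj d h (\<lambda>j. F j @ [(w, (x j + c) mod int n)]) w ((\<lambda>j. (x j + c) mod int n) ` {..<d})
    (U \<union> (\<Union>j<d. set [(w, (x j + c) mod int n)]))"
  proof (rule path_family_append[OF fam])
    fix j assume j: "j < d"
    show "distinct [(w, (x j + c) mod int n)] \<and> successively adj (last (F j) # [(w, (x j + c) mod int n)])
      \<and> fst (last (last (F j) # [(w, (x j + c) mod int n)])) = w
      \<and> snd (last (last (F j) # [(w, (x j + c) mod int n)])) = (x j + c) mod int n
      \<and> set [(w, (x j + c) mod int n)] \<inter> U = {}"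
      using adj_link[OF e xZ[OF j]] lF[OF j] w by (simp add: c_def)
  next
    fix i j assume ij: "i < d" "j < d" "i \<noteq> j"
    have "(x i + c) mod int n \<noteq> (x j + c) mod int n"
    proof
      assume "(x i + c) mod int n = (x j + c) mod int n"
      then have "(x i + c - c) mod int n = (x j + c - c) mod int n" by (metis mod_diff_cong)
      then have "x i = x j" using xZ ij by simp
      then show False using path_family_inj[OF fam] ij by (simp add: x_def)
    qed
    then show "set [(w, (x i + c) mod int n)] \<inter> set [(w, (x j + c) mod int n)] = {}" by simp
  qed
  moreover have "(\<lambda>j. (x j + c) mod int n) ` {..<d} = progression (b + c) d"
    unfolding progression_shift[symmetric] xim[symmetric] image_image ..
  moreover have "(\<Union>j<d. set [(w, (x j + c) mod int n)]) = {w} \<times> (\<lambda>j. (x j + c) mod int n) ` {..<d}"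
    by auto
  ultimately show ?thesis unfolding x_def c_def by simp
qed

end

section \<open>Bundles of billiard paths\<close>

lemma path_family_cong:
  assumes "path_family E d h F v X U" "\<And>j. j < d \<Longrightarrow> F' j = F j"
  shows "path_family E d h F' v X U"
  using assms by (simp add: path_family_def)

lemma rotation_image: "(\<lambda>j. (j + s) mod d) ` {..<d} = {..<d}" if "s < d" for s d :: nat
proof
  show "{..<d} \<subseteq> (\<lambda>j. (j + s) mod d) ` {..<d}"
  proof
    fix k assume "k \<in> {..<d}"
    then have "((k + (d - s)) mod d + s) mod d = k" using that by (simp add: mod_simps)
    then show "k \<in> (\<lambda>j. (j + s) mod d) ` {..<d}" using that by (metis imageI lessThan_iff less_nat_zero_code mod_less_divisor gr0I)
  qed
qed (use that in auto)

lemma is_path_conv_successively: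
  "is_path \<Gamma> p \<longleftrightarrow> p \<noteq> [] \<and> distinct p \<and> set p \<subseteq> verts \<Gamma> \<and> successively (\<lambda>a b. {a, b} \<in> edges \<Gamma>) p"
  by (simp add: is_path_def successively_conv_nth)

text \<open>Doubling undoes the halving, and rounding up only helps. This is the bound on
  \<open>d\<close> that the coset argument requires at inner vertices.\<close>

lemma gcd_le_twice_path_c:
  assumes "1 \<le> t" "t < length p - 1"
  shows "gcd (int n) (\<sigma> (Primary (p ! t))) \<le> int (2 * path_c n \<sigma> p)"
proof -
  let ?S = "{gcd (int n) (\<sigma> (Primary (p ! t))) | t. 1 \<le> t \<and> t < length p - 1}"
  let ?c = "\<lceil>real_of_int (Max ?S) / 2\<rceil>"
  have "?S = (\<lambda>t. gcd (int n) (\<sigma> (Primary (p ! t)))) ` {1..<length p - 1}" by auto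
  then have "finite ?S" by simp
  then have "gcd (int n) (\<sigma> (Primary (p ! t))) \<le> Max ?S" using assms by (intro Max_ge) auto
  moreover have "real_of_int (Max ?S) / 2 \<le> ?c" by (rule le_of_int_ceiling)
  then have "Max ?S \<le> 2 * ?c" by linarith
  moreover have "?c \<le> int (nat ?c)" by simp
  moreover have "path_c n \<sigma> p = nat ?c" using assms by (simp add: path_c_def)
  ultimately show ?thesis by simp
qed

text \<open>A path may be odd shifting only when reversed, while the weights are read off the given
  list.\<close>

lemma path_c_rev: "path_c n \<sigma> (rev p) = path_c n \<sigma> p"
proof -
  have sub: "{gcd (int n) (\<sigma> (Primary (rev q ! t))) | t. 1 \<le> t \<and> t < length q - 1}
    \<subseteq> {gcd (int n) (\<sigma> (Primary (q ! t))) | t. 1 \<le> t \<and> t < length q - 1}" for q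
  proof
    fix x assume "x \<in> {gcd (int n) (\<sigma> (Primary (rev q ! t))) | t. 1 \<le> t \<and> t < length q - 1}"
    then obtain t where t: "x = gcd (int n) (\<sigma> (Primary (rev q ! t)))" "1 \<le> t" "t < length q - 1" by blast
    then have "x = gcd (int n) (\<sigma> (Primary (q ! (length q - Suc t))))" by (simp add: rev_nth)
    moreover have "1 \<le> length q - Suc t" "length q - Suc t < length q - 1" using t by auto
    ultimately show "x \<in> {gcd (int n) (\<sigma> (Primary (q ! t))) | t. 1 \<le> t \<and> t < length q - 1}" by blast
  qed
  have "{gcd (int n) (\<sigma> (Primary (rev p ! t))) | t. 1 \<le> t \<and> t < length p - 1}
    = {gcd (int n) (\<sigma> (Primary (p ! t))) | t. 1 \<le> t \<and> t < length p - 1}"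
    using sub[of p] sub[of "rev p"] by (intro equalityI) simp_all
  then show ?thesis by (simp add: path_c_def)
qed

lemma inner_vertices:
  assumes "distinct p" "2 \<le> length p"
  shows "(!) p ` {1..<length p - 1} = set p - {hd p, last p}"
proof -
  have "p \<noteq> []" using assms by auto
  then have p: "hd p = p ! 0" "last p = p ! (length p - 1)" by (auto simp: hd_conv_nth last_conv_nth)
  show ?thesis
  proof (intro equalityI subsetI)
    fix v assume "v \<in> (!) p ` {1..<length p - 1}"
    then obtain i where "1 \<le> i" "i < length p - 1" "v = p ! i" by auto
    moreover from this have "i < length p" "0 < length p" by auto
    ultimately show "v \<in> set p - {hd p, last p}"
      using assms(2) p nth_eq_iff_index_eq[OF assms(1), of i 0]
        nth_eq_iff_index_eq[OF assms(1), of i "length p - 1"] by auto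
  next
    fix v assume v: "v \<in> set p - {hd p, last p}"
    then obtain i where i: "i < length p" "v = p ! i" by (auto simp: in_set_conv_nth)
    then have "i \<noteq> 0" "i \<noteq> length p - 1" using v p by (metis DiffD2 insertCI)+
    then have "i \<in> {1..<length p - 1}" using i(1) by auto
    then show "v \<in> (!) p ` {1..<length p - 1}" using i(2) by blast
  qed
qed

context coprime_lift
begin

text \<open>This is the invariant of the strategy: only \<open>d\<close> points over the first
  vertex, as round one does not move inside that fiber, then whole fibers over the inner vertices
  passed, and the arrival points over \<open>p ! t\<close>. The clause for \<open>t = 0\<close>
  identifies the first arrival progression with the starting one, so that the two end pieces of the
  union coincide there.\<close>

lemma billiard_family:
  assumes p: "is_path T p" and d: "d \<le> n"
    and g: "\<And>t. 1 \<le> t \<Longrightarrow> t < length p - 1 \<Longrightarrow> gcd (int n) (\<sigma> (Primary (p ! t))) \<le> int d"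
    and t: "t < length p"
  shows "\<exists>b. (t = 0 \<longrightarrow> b = 0) \<and>
    path_family adj d (\<lambda>j. (p ! 0, (int j * r) mod int n)) (billiard n \<sigma> p d r 0 t) (p ! t)
      (progression b d) ({p ! 0} \<times> progression 0 d \<union> ((!) p ` {1..<t}) \<times> Z \<union> {p ! t} \<times> progression b d)"
  using t
proof (induction t)
  case 0
  have "i = j" if "i < d" "j < d" "(int i * r) mod int n = (int j * r) mod int n" for i j
    using progression_inj[of i j 0] that d by simp
  then have "path_family adj d (\<lambda>j. (p ! 0, (int j * r) mod int n)) (billiard n \<sigma> p d r 0 0) (p ! 0)
      (progression 0 d) ({p ! 0} \<times> progression 0 d)"
    by (auto simp: path_family_def progression_def)
  then show ?case by (intro exI[of _ 0]) simp
next
  case (Suc t)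
  let ?h = "\<lambda>j. (p ! 0, (int j * r) mod int n)"
  define F where "F = billiard n \<sigma> p d r 0 t"
  define v where "v = p ! t"
  define w where "w = p ! Suc t"
  define a where "a = \<sigma> (Primary v)"
  define x where "x j = snd (last (F j))" for j
  obtain b where b0: "t = 0 \<longrightarrow> b = 0" and fam: "path_family adj d ?h F v (progression b d)
      ({p ! 0} \<times> progression 0 d \<union> ((!) p ` {1..<t}) \<times> Z \<union> {v} \<times> progression b d)"
    using Suc unfolding F_def v_def by auto
  define U where "U = {p ! 0} \<times> progression 0 d \<union> ((!) p ` {1..<t}) \<times> Z \<union> {v} \<times> progression b d"
  have fam: "path_family adj d ?h F v (progression b d) U" using fam by (simp add: U_def)
  have dist: "p ! i = p ! j \<longleftrightarrow> i = j" if "i \<le> Suc t" "j \<le> Suc t" for i j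
    using p that Suc.prems by (auto simp: is_path_def nth_eq_iff_index_eq)
  have e: "{v, w} \<in> edges T" "v \<in> verts T" using p Suc.prems by (auto simp: is_path_def v_def w_def)
  have "v \<noteq> w" using dist[of t "Suc t"] by (simp add: v_def w_def)
  have "w \<noteq> p ! i" if "i \<le> t" for i using dist[of i "Suc t"] that by (auto simp: w_def)
  then have "w \<notin> (!) p ` {..t}" by blast
  moreover have "U \<union> {v} \<times> Z \<subseteq> ((!) p ` {..t}) \<times> UNIV" by (auto simp: U_def v_def)
  ultimately have wU: "(w, y) \<notin> U \<union> {v} \<times> Z" for y by blast
  have X: "x ` {..<d} = progression b d" using fam by (auto simp: path_family_def x_def)
  show ?case
  proof (cases "t = 0")
    case True
    have "path_family adj d ?h (billiard n \<sigma> p d r 0 (Suc t)) w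
      (progression (b + \<sigma> (Link v w)) d) (U \<union> {w} \<times> progression (b + \<sigma> (Link v w)) d)"
      by (rule path_family_cong[OF path_family_link[OF fam e(1) \<open>v \<noteq> w\<close>]])
        (use wU True in \<open>auto simp: F_def v_def w_def Let_def\<close>)
    moreover have "U = {p ! 0} \<times> progression 0 d" using True b0 by (auto simp: U_def v_def)
    ultimately show ?thesis using True by (auto simp: w_def)
  next
    case False
    define s where "s j = fiber_steps n a (progression b d) (x j)" for j
    define F' where "F' j = F j @ map (\<lambda>i. (v, (x j + int i * a) mod int n)) [1..<Suc (s j)]" for j
    have "v \<noteq> p ! i" if "i < t" for i using dist[of i t] that by (auto simp: v_def)
    then have "v \<notin> (!) p ` {..<t}" by blast
    moreover have "{p ! 0} \<times> progression 0 d \<union> ((!) p ` {1..<t}) \<times> Z \<subseteq> ((!) p ` {..<t}) \<times> UNIV"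
      using False by auto
    ultimately have Uv: "(v, y) \<in> U \<longleftrightarrow> y \<in> progression b d" for y unfolding U_def by blast
    have "path_family adj d ?h F' v (progression (b - a) d) (U \<union> {v} \<times> Z)"
      unfolding F'_def x_def a_def
    proof (rule path_family_fiber[OF fam e(2) Uv])
      show "gcd (int n) (\<sigma> (Primary v)) \<le> int d" unfolding v_def by (rule g) (use False Suc.prems in auto)
    qed (simp add: s_def x_def a_def)
    note fam' = path_family_link[OF this e(1) \<open>v \<noteq> w\<close> wU]
    have "path_family adj d ?h (billiard n \<sigma> p d r 0 (Suc t)) w
      (progression (b - a + \<sigma> (Link v w)) d)
      (U \<union> {v} \<times> Z \<union> {w} \<times> progression (b - a + \<sigma> (Link v w)) d)"
    proof (rule path_family_cong[OF fam'])
      fix j assume j: "j < d"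
      \<comment> \<open>If \<open>s j = 0\<close>, nothing was appended and the last value is
        \<open>x j\<close>, which is its own residue since it lies in \<open>Z\<close>.\<close>
      have "x j \<in> Z" using X progression_subset j by blast
      then have "snd (last (F' j)) = (x j + int (s j) * a) mod int n"
        by (cases "s j") (auto simp: F'_def x_def)
      then have "(snd (last (F' j)) + \<sigma> (Link v w)) mod int n = (x j + int (s j) * a + \<sigma> (Link v w)) mod int n"
        by (simp add: mod_simps)
      moreover have "billiard n \<sigma> p d r 0 (Suc t) j
        = F' j @ [(w, (x j + int (s j) * a + \<sigma> (Link v w)) mod int n)]"
        using False X unfolding F'_def s_def x_def a_def v_def w_def F_def
        by (simp add: Let_def del: upt_Suc)
      ultimately show "billiard n \<sigma> p d r 0 (Suc t) j
        = F' j @ [(w, (snd (last (F' j)) + \<sigma> (Link v w)) mod int n)]" by simp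
    qed
    moreover have "U \<union> {v} \<times> Z = {p ! 0} \<times> progression 0 d \<union> ((!) p ` {1..<Suc t}) \<times> Z"
    proof -
      have "{1..<Suc t} = insert t {1..<t}" using False by auto
      then show ?thesis using progression_subset[of b d] by (auto simp: U_def v_def)
    qed
    ultimately show ?thesis by (auto simp: w_def)
  qed
qed

text \<open>The arrival index \<open>(j + s) mod d\<close> inverts \<open>shifted_index d s\<close>;
  in this form translation and reversal preserve the notion. \<open>I\<close> holds the inner
  vertices, whose fibers are covered completely, while over \<open>u\<close> and \<open>w\<close>
  only \<open>d\<close> points are used.\<close>

definition path_bundle ::
    "nat \<Rightarrow> 'v \<Rightarrow> 'v \<Rightarrow> 'v set \<Rightarrow> int \<Rightarrow> int \<Rightarrow> nat \<Rightarrow> (nat \<Rightarrow> ('v \<times> int) list) \<Rightarrow> bool" where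
  "path_bundle d u w I l l' s R \<longleftrightarrow>
     (\<forall>j<d. R j \<noteq> [] \<and> distinct (R j) \<and> successively adj (R j) \<and>
        hd (R j) = (u, (l + int j * r) mod int n) \<and>
        last (R j) = (w, (l' + int ((j + s) mod d) * r) mod int n)) \<and>
     (\<forall>i<d. \<forall>j<d. i \<noteq> j \<longrightarrow> set (R i) \<inter> set (R j) = {}) \<and>
     (\<Union>j<d. set (R j)) = {u} \<times> progression l d \<union> I \<times> Z \<union> {w} \<times> progression l' d"

text \<open>Adjacency in the lift depends only on differences of values, so adding \<open>g\<close>
  to every second coordinate is an automorphism. It moves the strategy started at 0 to wherever a
  joint fiber still has room.\<close>

lemma bundle_translate:
  assumes "path_bundle d u w I l l' s R"
  shows "path_bundle d u w I (l + g) (l' + g) s (\<lambda>j. map (\<lambda>(v, x). (v, (x + g) mod int n)) (R j))"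
proof -
  define \<tau> :: "'v \<times> int \<Rightarrow> 'v \<times> int" where "\<tau> = (\<lambda>(v, x). (v, (x + g) mod int n))"
  have \<tau>: "\<tau> (v, x) = (v, (x + g) mod int n)" for v x by (simp add: \<tau>_def)
  have adj: "adj (\<tau> p) (\<tau> q)" if pq: "adj p q" for p q
  proof -
    from pq obtain e a b where e: "{p, q} = {(arc_tail e, a), (arc_head e, b)}" "a \<in> Z" "b \<in> Z" "e \<in> arcs T"
      "\<sigma> e = (- a mod int n + b) mod int n"
      using n by (auto simp: lift_graph_def carrier_integer_mod_group)
    have "(a + \<sigma> e) mod int n = b" unfolding e(5) using e(3) by (simp add: mod_simps)
    then have "\<tau> (arc_head e, b) = (arc_head e, ((a + g) mod int n + \<sigma> e) mod int n)"
      by (auto simp: \<tau> mod_simps algebra_simps)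
    moreover have "{\<tau> p, \<tau> q} = \<tau> ` {p, q}" by simp
    ultimately show ?thesis
      using adj_arc[OF e(4) mod_in_Z, of "a + g"] unfolding e(1) by (simp add: \<tau>)
  qed
  have sub: "set (R j) \<subseteq> UNIV \<times> Z" if "j < d" for j
  proof -
    have "set (R j) \<subseteq> {u} \<times> progression l d \<union> I \<times> Z \<union> {w} \<times> progression l' d"
      using assms that unfolding path_bundle_def by blast
    then show ?thesis using progression_subset by blast
  qed
  have inj: "inj_on \<tau> (UNIV \<times> Z)"
  proof (rule inj_onI, clarify)
    fix v v' :: 'v and x x' assume *: "x \<in> Z" "x' \<in> Z" "\<tau> (v, x) = \<tau> (v', x')"
    then have "(x + g - g) mod int n = (x' + g - g) mod int n" unfolding \<tau> by (metis mod_diff_cong prod.inject)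
    then show "v = v' \<and> x = x'" using * by (simp add: \<tau>)
  qed
  have im: "\<tau> ` ({v} \<times> progression b e) = {v} \<times> progression (b + g) e" for v b e
    unfolding progression_shift[symmetric] by (auto simp: \<tau>_def)
  \<comment> \<open>\<open>Z\<close> is itself a progression, of length \<open>n\<close>, so
    \<open>im\<close> applies to it.\<close>
  have imZ: "\<tau> ` ({v} \<times> Z) = {v} \<times> Z" for v
    using im[of v 0 n] by (simp only: progression_full)
  have "I \<times> Z = (\<Union>v\<in>I. {v} \<times> Z)" by blast
  then have imI: "\<tau> ` (I \<times> Z) = I \<times> Z" by (simp only: image_UN imZ)
  have "(\<Union>j<d. set (map \<tau> (R j))) = \<tau> ` (\<Union>j<d. set (R j))" by auto
  also have "\<dots> = {u} \<times> progression (l + g) d \<union> I \<times> Z \<union> {w} \<times> progression (l' + g) d"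
    using assms by (simp only: path_bundle_def image_Un im imI)
  finally have U: "(\<Union>j<d. set (map \<tau> (R j))) = \<dots>" .
  moreover have "set (map \<tau> (R i)) \<inter> set (map \<tau> (R j)) = {}" if "i < d" "j < d" "i \<noteq> j" for i j
  proof -
    have "set (map \<tau> (R i)) \<inter> set (map \<tau> (R j)) = \<tau> ` (set (R i) \<inter> set (R j))"
      unfolding set_map by (rule inj_on_image_Int[OF inj sub sub, symmetric]) (use that in auto)
    then show ?thesis using assms that by (simp add: path_bundle_def)
  qed
  moreover have "distinct (map \<tau> (R j)) \<and> successively adj (map \<tau> (R j))" if "j < d" for j
  proof -
    have "distinct (R j)" "successively adj (R j)" using assms that by (auto simp: path_bundle_def)
    then show ?thesis using inj_on_subset[OF inj sub[OF that]] adj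
      by (auto simp: distinct_map successively_map elim!: successively_mono)
  qed
  moreover have "hd (map \<tau> (R j)) = (u, (l + g + int j * r) mod int n)
      \<and> last (map \<tau> (R j)) = (w, (l' + g + int ((j + s) mod d) * r) mod int n) \<and> map \<tau> (R j) \<noteq> []"
    if "j < d" for j
    using assms that by (auto simp: path_bundle_def hd_map last_map \<tau> mod_simps algebra_simps)
  ultimately have "path_bundle d u w I (l + g) (l' + g) s (\<lambda>j. map \<tau> (R j))"
    unfolding path_bundle_def by presburger
  then show ?thesis unfolding \<tau>_def .
qed

text \<open>Indexing the reversed paths by their old arrival position turns the shift by
  \<open>s\<close> into its inverse, the shift by \<open>d - s\<close>.\<close>

lemma bundle_reverse:
  assumes B: "path_bundle d u w I l l' s R" and s: "s < d"
  shows "path_bundle d w u I l' l (d - s) (\<lambda>k. rev (R ((k + (d - s)) mod d)))"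
proof -
  define j where "j k = (k + (d - s)) mod d" for k
  have jd: "j k < d" for k using s by (simp add: j_def)
  have js: "(j k + s) mod d = k" if "k < d" for k using that s by (simp add: j_def mod_simps)
  \<comment> \<open>For \<open>s = 0\<close> the inverse shift is \<open>d\<close> itself, outside
    the range of \<open>rotation_image\<close>, but then \<open>j\<close> is the identity below
    \<open>d\<close>.\<close>
  have jim: "j ` {..<d} = {..<d}"
  proof (cases "s = 0")
    case True then show ?thesis by (auto simp: j_def)
  next
    case False then show ?thesis unfolding j_def using s by (intro rotation_image) simp
  qed
  have symr: "successively (\<lambda>a b. adj b a) xs" if "successively adj xs" for xs
    using that by (rule successively_mono) (simp add: insert_commute)
  have "(\<Union>k<d. set (rev (R (j k)))) = (\<Union>k\<in>j ` {..<d}. set (R k))" by simp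
  also have "\<dots> = {w} \<times> progression l' d \<union> I \<times> Z \<union> {u} \<times> progression l d"
    using B unfolding jim path_bundle_def by blast
  finally have "(\<Union>k<d. set (rev (R (j k)))) = \<dots>" .
  moreover have "rev (R (j k)) \<noteq> [] \<and> distinct (rev (R (j k))) \<and> successively adj (rev (R (j k))) \<and>
     hd (rev (R (j k))) = (w, (l' + int k * r) mod int n) \<and>
     last (rev (R (j k))) = (u, (l + int (j k) * r) mod int n)" if "k < d" for k
    using B jd[of k] js[OF that] symr[of "R (j k)"] by (auto simp: path_bundle_def hd_rev last_rev)
  moreover have "set (rev (R (j k))) \<inter> set (rev (R (j k'))) = {}" if "k < d" "k' < d" "k \<noteq> k'" for k k'
  proof -
    have "j k \<noteq> j k'" using js that by metis
    then show ?thesis using B jd unfolding path_bundle_def set_rev by blast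
  qed
  ultimately show ?thesis unfolding path_bundle_def j_def by blast
qed

text \<open>\<open>billiard_family\<close> gives disjointness and coverage with some unnamed arrival
  progression, the odd shifting condition gives the individual arrival points. Rotating the indices
  by \<open>s\<close> permutes them, so both progressions are the same set.\<close>

lemma bundle_of_odd_shifting_sequence:
  assumes p: "is_path T p" and odd: "odd_shifting_sequence n \<sigma> p" and r: "\<sigma> (Primary (hd p)) = r"
  shows "\<exists>R l' s. odd s \<and> s < 2 * path_c n \<sigma> p \<and>
    path_bundle (2 * path_c n \<sigma> p) (hd p) (last p) (set p - {hd p, last p}) 0 l' s R"
proof -
  define d where "d = 2 * path_c n \<sigma> p"
  define F where "F = billiard n \<sigma> p d r 0 (length p - 1)"
  define l' where "l' = path_beta \<sigma> p 0"
  have len: "2 \<le> length p" using odd by (simp add: odd_shifting_sequence_def)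
  have "gcd r (int n) = 1" using coprime by simp
  then have d: "d \<le> n" using odd r by (simp add: odd_shifting_sequence_def Let_def d_def)
  obtain s where s: "odd s" "s < d"
    and arr: "\<And>k. k < d \<Longrightarrow> last (F (shifted_index d s k)) = (last p, (l' + int k * r) mod int n)"
    using odd r unfolding odd_shifting_sequence_def Let_def d_def F_def l'_def by blast
  have arr: "last (F j) = (last p, (l' + int ((j + s) mod d) * r) mod int n)" if "j < d" for j
  proof -
    have "shifted_index d s ((j + s) mod d) = j"
      using s that by (cases "j + s < d") (auto simp: shifted_index_def le_mod_geq)
    then show ?thesis using arr[of "(j + s) mod d"] s by (simp add: that)
  qed
  have "p \<noteq> []" using len by auto
  then have pp: "hd p = p ! 0" "last p = p ! (length p - 1)" by (auto simp: hd_conv_nth last_conv_nth)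
  have "length p - 1 < length p" using len by simp
  have g: "gcd (int n) (\<sigma> (Primary (p ! t))) \<le> int d" if "1 \<le> t" "t < length p - 1" for t
    using gcd_le_twice_path_c[OF that] by (simp add: d_def)
  obtain b where fam: "path_family adj d (\<lambda>j. (p ! 0, (int j * r) mod int n)) F (p ! (length p - 1))
      (progression b d)
      ({p ! 0} \<times> progression 0 d \<union> ((!) p ` {1..<length p - 1}) \<times> Z \<union> {p ! (length p - 1)} \<times> progression b d)"
    using billiard_family[OF p d g \<open>length p - 1 < length p\<close>] unfolding F_def by blast
  have "progression b d = (\<lambda>j. snd (last (F j))) ` {..<d}" using fam by (simp add: path_family_def)
  also have "\<dots> = (\<lambda>j. (l' + int ((j + s) mod d) * r) mod int n) ` {..<d}"
    by (rule image_cong) (simp_all add: arr)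
  also have "\<dots> = (\<lambda>k. (l' + int k * r) mod int n) ` ((\<lambda>j. (j + s) mod d) ` {..<d})"
    by (rule image_image[symmetric])
  also have "\<dots> = progression l' d" unfolding rotation_image[OF s(2)] progression_def ..
  finally have b: "progression b d = progression l' d" .
  have "distinct p" using p by (simp add: is_path_def)
  note I = inner_vertices[OF this len]
  have "path_bundle d (hd p) (last p) (set p - {hd p, last p}) 0 l' s F"
    using fam arr I unfolding path_family_def path_bundle_def b pp by simp
  then show ?thesis using s unfolding d_def by blast
qed

text \<open>A path has to be attachable at whichever end the tour has reached, though it may be odd
  shifting in one direction only. From the far end the reversed bundle serves; its shift
  \<open>d - s\<close> is odd because \<open>d\<close> is even. Translation then adjusts the
  starting value.\<close>

lemma bundle_from_endpoint:
  assumes Q: "odd_shifting_path n T \<sigma> Q" and u: "u \<in> endpoints Q"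
    and r: "\<forall>u\<in>endpoints Q. \<sigma> (Primary u) = r" and d: "d = 2 * path_c n \<sigma> Q"
  shows "\<exists>w. endpoints Q = {u, w} \<and> u \<noteq> w \<and>
    (\<forall>l. \<exists>R l' s. odd s \<and> s < d \<and> path_bundle d u w (set Q - {u, w}) l l' s R)"
proof -
  have path: "is_path T Q" using Q by (simp add: odd_shifting_path_def)
  then have path': "is_path T (rev Q)" by (simp add: is_path_conv_successively insert_commute)
  obtain q where q: "q = Q \<or> q = rev Q" "odd_shifting_sequence n \<sigma> q"
    using Q by (auto simp: odd_shifting_path_def)
  have len: "2 \<le> length q" using q(2) by (simp add: odd_shifting_sequence_def)
  have "Q \<noteq> []" using len q(1) by auto
  have eq: "set q = set Q" "path_c n \<sigma> q = path_c n \<sigma> Q" "{hd q, last q} = endpoints Q" "is_path T q"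
    using q(1) path path' \<open>Q \<noteq> []\<close> by (auto simp: path_c_rev endpoints_def hd_rev last_rev)
  have "distinct q" using eq by (simp add: is_path_def)
  then have ne: "hd q \<noteq> last q" using len
    by (cases q) auto
  have "\<sigma> (Primary (hd q)) = r" using r eq(3) by blast
  from bundle_of_odd_shifting_sequence[OF eq(4) q(2) this]
  obtain R l' s where B: "odd s" "s < d" "path_bundle d (hd q) (last q) (set Q - {hd q, last q}) 0 l' s R"
    unfolding eq(1,2) d[symmetric] by blast
  consider "u = hd q" | "u = last q" using u eq(3) by blast
  then show ?thesis
  proof cases
    case 1
    have "\<exists>R l' s. odd s \<and> s < d \<and> path_bundle d u (last q) (set Q - {u, last q}) l l' s R" for l
      using bundle_translate[OF B(3), of l] B(1,2) unfolding 1 add_0 by blast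
    then show ?thesis using eq(3) ne 1 by blast
  next
    case 2
    have "even d" by (simp add: d)
    then have s': "odd (d - s)" "d - s < d" using B(1,2) by (auto elim: oddE intro!: Nat.gr0I)
    have *: "set Q - {hd q, last q} = set Q - {last q, hd q}" "l' + (l - l') = l" for l by auto
    have "\<exists>R l' s. odd s \<and> s < d \<and> path_bundle d u (hd q) (set Q - {u, hd q}) l l' s R" for l
      using bundle_translate[OF bundle_reverse[OF B(3,2)], of "l - l'"] s' unfolding 2 * by blast
    moreover have "endpoints Q = {u, hd q}" "u \<noteq> hd q" using eq(3) ne 2 by auto
    ultimately show ?thesis by blast
  qed
qed

end

section \<open>Tours of the lift\<close>

lemma distinct_concat_map_upt:
  assumes "\<And>j. j < d \<Longrightarrow> distinct (R j)"
    and "\<And>i j. i < d \<Longrightarrow> j < d \<Longrightarrow> i \<noteq> j \<Longrightarrow> set (R i) \<inter> set (R j) = {}"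
  shows "distinct (concat (map R [0..<d]))"
  using assms
proof (induction d)
  case (Suc d)
  have "set (R i) \<inter> set (R d) = {}" if "i < d" for i using Suc.prems(2)[of i d] that by simp
  then have "(\<Union>i<d. set (R i)) \<inter> set (R d) = {}" by blast
  moreover have "distinct (concat (map R [0..<d]))" using Suc by simp
  ultimately show ?case using Suc.prems(1)[of d] by (simp add: atLeast0LessThan)
qed simp

locale decomposed_lift = coprime_lift n T \<sigma> r
  for n :: nat and T :: "'v ugraph" and \<sigma> :: "'v arc \<Rightarrow> int" and r :: int +
  fixes \<Q> :: "'v list set"
  assumes tree: "reflexive_tree T"
    and decomposition: "odd_shifting_decomposition n T \<sigma> \<Q>"
    and endpoint_voltage: "\<forall>Q\<in>\<Q>. \<forall>u\<in>endpoints Q. \<sigma> (Primary u) = r"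
    and weights: "properly_weighted n \<sigma> \<Q>"
begin

lemma finite_\<Q>: "finite \<Q>"
  using decomposition by (simp add: odd_shifting_decomposition_def)

lemma odd_shifting: "Q \<in> \<Q> \<Longrightarrow> odd_shifting_path n T \<sigma> Q"
  using decomposition by (simp add: odd_shifting_decomposition_def)

lemma path: "Q \<in> \<Q> \<Longrightarrow> is_path T Q"
  using odd_shifting by (simp add: odd_shifting_path_def)

lemma length_ge_2: "Q \<in> \<Q> \<Longrightarrow> 2 \<le> length Q"
  using odd_shifting by (auto simp: odd_shifting_path_def odd_shifting_sequence_def)

lemma endpoints_subset: "Q \<in> \<Q> \<Longrightarrow> endpoints Q \<subseteq> set Q"
  using path by (auto simp: is_path_def endpoints_def)

lemma common_vertex_endpoint:
  assumes "Q \<in> \<Q>" "Q' \<in> \<Q>" "Q \<noteq> Q'" "v \<in> set Q" "v \<in> set Q'"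
  shows "v \<in> endpoints Q"
  using decomposition assms unfolding odd_shifting_decomposition_def by blast

lemma joint_endpoint:
  assumes "Q \<in> \<Q>" "v \<in> joints \<Q>" "v \<in> set Q"
  shows "v \<in> endpoints Q"
proof -
  obtain Q' where "Q' \<in> \<Q>" "v \<in> endpoints Q'" using assms by (auto simp: joints_def)
  then show ?thesis using common_vertex_endpoint[OF assms(1), of Q'] assms endpoints_subset by blast
qed

section \<open>The decomposition and the tree structure\<close>

definition linked :: "'v list set \<Rightarrow> 'v \<Rightarrow> 'v \<Rightarrow> bool" where
  "linked S a b \<longleftrightarrow> (\<exists>Q\<in>S. {a, b} \<in> link_edges Q)"

lemma symp_linked: "symp (linked S)"
  by (auto intro!: sympI simp: linked_def insert_commute)

lemma link_edges_vertices: "{a, b} \<in> link_edges Q \<Longrightarrow> a \<in> set Q \<and> b \<in> set Q"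
  by (auto simp: link_edges_def doubleton_eq_iff)

lemma linked_edge:
  assumes "S \<subseteq> \<Q>" "linked S a b"
  shows "{a, b} \<in> edges T"
proof -
  have "(\<Union>Q\<in>\<Q>. link_edges Q) = edges T - loops T"
    using decomposition by (simp add: odd_shifting_decomposition_def)
  then show ?thesis using assms unfolding linked_def by blast
qed

lemma linked_successively: "Q \<in> S \<Longrightarrow> successively (linked S) Q"
  by (auto simp: successively_conv_nth linked_def link_edges_def)

text \<open>A connection between the ends of \<open>Q\<close> through paths of \<open>S\<close>,
  shortened to a simple path, would close \<open>Q\<close> to a cycle of the tree.\<close>

lemma acyclic_attachment:
  assumes S: "S \<subseteq> \<Q>" and Q: "Q \<in> \<Q>" "Q \<notin> S"
  shows "\<not> (linked S)\<^sup>*\<^sup>* (last Q) (hd Q)"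
proof
  assume "(linked S)\<^sup>*\<^sup>* (last Q) (hd Q)"
  then obtain p where p: "p \<noteq> []" "distinct p" "successively (linked S) p" "hd p = last Q" "last p = hd Q"
    using rtranclp_imp_path by metis
  have Qp: "Q \<noteq> []" "distinct Q" "set Q \<subseteq> verts T" "successively (\<lambda>a b. {a, b} \<in> edges T) Q"
    using path[OF Q(1)] by (auto simp: is_path_conv_successively)
  have len: "2 \<le> length Q" using length_ge_2[OF Q(1)] .
  then have ne: "hd Q \<noteq> last Q" using Qp by (cases Q) auto
  obtain m where m: "p = last Q # m @ [hd Q]"
  proof -
    obtain p' where p': "p = last Q # p'" using p by (cases p) auto
    then have "p' \<noteq> []" "last p' = hd Q" using p ne by (auto split: if_splits)
    then have "p' = butlast p' @ [hd Q]" by (metis append_butlast_last_id)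
    then show thesis using that p' by metis
  qed
  have edge: "successively (\<lambda>a b. {a, b} \<in> edges T) p"
    using p(3) by (rule successively_mono) (rule linked_edge[OF S])
  have mQ: "\<exists>Q'\<in>S. z \<in> set Q'" if z: "z \<in> set m" for z
  proof -
    obtain m1 m2 where "m = m1 @ z # m2" using z by (meson split_list)
    then have "linked S z (hd (m2 @ [hd Q]))" using p(3) m by (simp add: successively_append_iff successively_Cons)
    then obtain Q' where "Q' \<in> S" "{z, hd (m2 @ [hd Q])} \<in> link_edges Q'"
      unfolding linked_def by blast
    then show ?thesis using link_edges_vertices[of z "hd (m2 @ [hd Q])" Q'] by blast
  qed
  \<comment> \<open>An inner vertex of the connection lying on \<open>Q\<close> would be shared with
    a path of \<open>S\<close>, hence be an end of \<open>Q\<close>; but the ends of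
    \<open>Q\<close> are already the ends of \<open>p\<close>.\<close>
  have disj: "set Q \<inter> set m = {}"
  proof (rule ccontr)
    assume "set Q \<inter> set m \<noteq> {}"
    then obtain z where z: "z \<in> set Q" "z \<in> set m" by blast
    then obtain Q' where "Q' \<in> S" "z \<in> set Q'" using mQ by blast
    then have "z \<in> endpoints Q" using common_vertex_endpoint[OF Q(1), of Q' z] S Q z by blast
    then show False using z(2) p(2) m by (auto simp: endpoints_def)
  qed
  have "set m \<subseteq> verts T" using mQ S path unfolding is_path_def by blast
  moreover have "successively (\<lambda>a b. {a, b} \<in> edges T) (Q @ m)" "{last (Q @ m), hd (Q @ m)} \<in> edges T"
    using edge Qp unfolding m by (auto simp: successively_append_iff successively_Cons hd_append split: if_splits)
  \<comment> \<open>Otherwise \<open>Q\<close> and the connection are the same single edge, which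
    would belong to two paths of the decomposition.\<close>
  moreover have "3 \<le> length (Q @ m)"
  proof (rule ccontr)
    assume "\<not> 3 \<le> length (Q @ m)"
    then have "length Q + length m < 3" unfolding length_append by linarith
    then have "length Q = 2" "length m = 0" using len by linarith+
    then have "m = []" by simp
    obtain a b where ab: "Q = [a, b]" using \<open>length Q = 2\<close> by (auto simp: length_Suc_conv numeral_2_eq_2)
    obtain Q' where Q': "Q' \<in> S" "{b, a} \<in> link_edges Q'"
      using p(3) unfolding m \<open>m = []\<close> ab by (auto simp: linked_def)
    moreover have "{b, a} \<in> link_edges Q" by (auto simp: link_edges_def ab)
    moreover have "disjoint_family_on link_edges \<Q>"
      using decomposition by (simp add: odd_shifting_decomposition_def)
    then have "link_edges Q \<inter> link_edges Q' = {}"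
      by (rule disjoint_family_onD) (use Q S Q'(1) in auto)
    ultimately show False by blast
  qed
  ultimately have "is_cycle T (Q @ m)"
    using Qp p(2) disj by (auto simp: is_cycle_def is_path_conv_successively m)
  then show False using tree by (auto simp: reflexive_tree_def)
qed

lemma frontier:
  assumes "W \<subseteq> verts T" "W \<noteq> {}" "W \<noteq> verts T"
  shows "\<exists>Q\<in>\<Q>. \<exists>a b. a \<in> W \<and> a \<in> set Q \<and> b \<notin> W \<and> b \<in> set Q"
proof -
  obtain u z where uz: "u \<in> W" "z \<in> verts T" "z \<notin> W" using assms by blast
  then obtain p where p: "is_path T p" "hd p = u" "last p = z"
    using tree assms(1) unfolding reflexive_tree_def connected_graph_def by blast
  then obtain a b where ab: "{a, b} \<in> edges T" "a \<in> W" "b \<notin> W"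
    using successively_crossing[of "\<lambda>a b. {a, b} \<in> edges T" p W] uz by (auto simp: is_path_conv_successively)
  then have "{a, b} \<in> edges T - loops T" by (auto simp: loops_def)
  moreover have "(\<Union>Q\<in>\<Q>. link_edges Q) = edges T - loops T"
    using decomposition by (simp add: odd_shifting_decomposition_def)
  ultimately obtain Q where "Q \<in> \<Q>" "{a, b} \<in> link_edges Q" by blast
  then show ?thesis using link_edges_vertices[of a b Q] ab by blast
qed

section \<open>Joint fibers and the growth of the tour\<close>

definition fiber_point :: "'v \<Rightarrow> int \<Rightarrow> nat \<Rightarrow> 'v \<times> int" where
  "fiber_point v b i = (v, (b + int i * r) mod int n)"

lemma fiber_point_shift: "map (fiber_point v b) [d..<k] = map (fiber_point v (b + int d * r)) [0..<k - d]"
  by (rule nth_equalityI) (auto simp: fiber_point_def algebra_simps)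

lemma fiber_point_walk:
  assumes "v \<in> joints \<Q>"
  shows "successively adj (map (fiber_point v b) [0..<n])" "adj (fiber_point v b (n - 1)) (fiber_point v b 0)"
proof -
  obtain Q where Q: "Q \<in> \<Q>" "v \<in> endpoints Q" using assms by (auto simp: joints_def)
  then have "v \<in> verts T" "\<sigma> (Primary v) = r"
    using endpoints_subset path endpoint_voltage by (auto simp: is_path_def)
  then have step: "adj (fiber_point v b i) (fiber_point v b (Suc i))" for i
    using adj_loop[OF _ mod_in_Z, of v "b + int i * r"] by (simp add: fiber_point_def mod_simps algebra_simps)
  then show "successively adj (map (fiber_point v b) [0..<n])" by (simp add: successively_conv_nth)
  have "fiber_point v b n = fiber_point v b 0" by (simp add: fiber_point_def)
  then show "adj (fiber_point v b (n - 1)) (fiber_point v b 0)" using step[of "n - 1"] n by simp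
qed

lemma fiber_point_inj: "inj_on (fiber_point v b) {..<n}"
  by (auto intro!: inj_onI dest: progression_inj simp: fiber_point_def)

lemma fiber_point_image: "fiber_point v b ` {..<d} = {v} \<times> progression b d"
  by (auto simp: fiber_point_def progression_def)

text \<open>The last clause keeps, in each joint fiber, the vertices not yet used as ends of billiard paths
  as one contiguous stretch of the cycle; this is the room for the paths still to be attached.\<close>

definition tour :: "'v list set \<Rightarrow> 'v set \<Rightarrow> ('v \<times> int) list \<Rightarrow> bool" where
  "tour S W C \<longleftrightarrow> distinct C \<and> closed_walk adj C \<and> set C = W \<times> Z \<and>
     (\<forall>v\<in>W \<inter> joints \<Q>. \<exists>b A B. C = A @ map (fiber_point v b) [0..<n - joint_weight n \<sigma> S v] @ B)"

lemma joint_weight_insert: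
  assumes "S \<subseteq> \<Q>" "Q \<notin> S"
  shows "joint_weight n \<sigma> (insert Q S) v
    = (if v \<in> endpoints Q then 2 * path_c n \<sigma> Q else 0) + joint_weight n \<sigma> S v"
proof -
  have "finite S" using assms finite_\<Q> finite_subset by blast
  then have *: "joint_weight n \<sigma> S' v = (\<Sum>Q\<in>S'. if v \<in> endpoints Q then 2 * path_c n \<sigma> Q else 0)"
    if "S' = S \<or> S' = insert Q S" for S'
    unfolding joint_weight_def using that by (subst sum.inter_filter[symmetric]) auto
  show ?thesis using * \<open>finite S\<close> assms by simp
qed

lemma joint_weight_le:
  assumes "S \<subseteq> \<Q>" "v \<in> joints \<Q>"
  shows "joint_weight n \<sigma> S v \<le> n"
proof -
  have "joint_weight n \<sigma> S v \<le> joint_weight n \<sigma> \<Q> v"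
    unfolding joint_weight_def using assms finite_\<Q> by (intro sum_mono2) auto
  then show ?thesis using weights assms by (force simp: properly_weighted_def)
qed

text \<open>Of the free stretch at \<open>u\<close> the first \<open>d\<close> points
  \<open>F\<close> are spent and the rest \<open>G\<close> stays free. At the new joint
  \<open>w\<close> the arrival points are spent and \<open>N\<close> stays free. At any other joint
  of \<open>W\<close> the stretch survives because it is disjoint from \<open>F\<close>.\<close>

lemma tour_extend:
  assumes C: "tour S W C" and S: "S \<subseteq> \<Q>" "\<And>Q'. Q' \<in> S \<Longrightarrow> set Q' \<subseteq> W" and Q: "Q \<in> \<Q>" "Q \<notin> S"
    and u: "u \<in> endpoints Q" "W \<inter> set Q = {u}"
  shows "\<exists>C'. tour (insert Q S) (W \<union> set Q) C'"
proof -
  define d where "d = 2 * path_c n \<sigma> Q"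
  obtain w where w: "endpoints Q = {u, w}" "u \<noteq> w"
    and bundles: "\<And>l. \<exists>R l' s. odd s \<and> s < d \<and> path_bundle d u w (set Q - {u, w}) l l' s R"
    using bundle_from_endpoint[OF odd_shifting[OF Q(1)] u(1) _ d_def] endpoint_voltage Q(1) by blast
  have uw: "u \<in> joints \<Q>" "w \<in> joints \<Q>" using Q(1) w by (auto simp: joints_def)
  have wQ: "w \<in> set Q" "u \<in> set Q" using endpoints_subset[OF Q(1)] w by auto
  then have wW: "w \<notin> W" "u \<in> W" using u(2) w by auto
  define k where "k = n - joint_weight n \<sigma> S u"
  obtain b A B where CAB: "C = A @ map (fiber_point u b) [0..<k] @ B"
    using C uw wW unfolding tour_def k_def by blast
  obtain R l' s where s: "odd s" "s < d" and R: "path_bundle d u w (set Q - {u, w}) b l' s R"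
    using bundles by blast
  have "joint_weight n \<sigma> (insert Q S) u \<le> n" using joint_weight_le[of "insert Q S" u] S Q uw by blast
  then have dk: "d \<le> k" "k \<le> n" using joint_weight_insert[OF S(1) Q(2), of u] u(1) by (auto simp: k_def d_def)
  define x where "x = fiber_point u b"
  define y where "y = fiber_point w l'"
  define F where "F = map x [0..<d]"
  define G where "G = map x [d..<k]"
  define N where "N = map y [d..<n]"
  \<comment> \<open>The old cycle is rotated to begin with \<open>F\<close>; what follows starts
    with \<open>G\<close>, so the rest of the free stretch at \<open>u\<close> is one block.\<close>
  define M where "M = G @ B @ A"
  have "[0..<k] = [0..<d] @ [d..<k]" using dk by (metis le_add_diff_inverse upt_add_eq_append zero_le)
  then have CFG: "C = A @ F @ G @ B" by (simp add: CAB F_def G_def x_def)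
  then have "closed_walk adj (F @ M)"
    using C closed_walk_rotate[of adj A "F @ G @ B"] by (simp add: tour_def M_def)
  moreover have "R j \<noteq> [] \<and> successively adj (R j) \<and> hd (R j) = x j \<and> last (R j) = y ((j + s) mod d)"
    if "j < d" for j
    using R that by (simp add: path_bundle_def x_def y_def fiber_point_def)
  moreover have "0 < path_c n \<sigma> Q" using s by (simp add: d_def)
  ultimately obtain A' B' where C': "closed_walk adj (A' @ N @ B' @ M)"
    and mset: "mset (A' @ N @ B' @ M) = (\<Sum>j<d. mset (R j)) + mset N + mset M"
    using weave_bundle[OF symp_adj d_def, of n s x M R y] s dk fiber_point_walk[OF uw(2), of l']
    unfolding F_def N_def y_def by auto
  \<comment> \<open>The new cycle sorted by its constituents: distinctness and vertex set depend
    only on the multiset and are easier to read off here.\<close>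
  define L where "L = concat (map R [0..<d]) @ N @ M"
  have msetL: "mset (A' @ N @ B' @ M) = mset L"
    unfolding mset L_def by (simp add: mset_concat_map_upt)
  have setF: "set F = {u} \<times> progression b d"
    unfolding F_def x_def by (simp add: atLeast0LessThan fiber_point_image)
  have setR: "set (concat (map R [0..<d])) = set F \<union> (set Q - {u, w}) \<times> Z \<union> {w} \<times> progression l' d"
    using R unfolding setF by (simp add: path_bundle_def atLeast0LessThan)
  have dC: "distinct C" "set C = W \<times> Z" using C by (auto simp: tour_def)
  have setM: "set M = W \<times> Z - set F" "distinct M" using dC unfolding CFG M_def by auto
  have Nw: "set N \<subseteq> {w} \<times> Z" using n by (auto simp: N_def y_def fiber_point_def)
  have yfull: "{w} \<times> progression l' d \<union> set N = {w} \<times> Z"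
  proof -
    have "{w} \<times> progression l' d \<union> set N = y ` ({..<d} \<union> {d..<n})"
      unfolding fiber_point_image[symmetric] N_def y_def by (simp add: image_Un)
    also have "{..<d} \<union> {d..<n} = {..<n}" using dk by auto
    finally show ?thesis unfolding y_def fiber_point_image progression_full .
  qed
  have RN: "{w} \<times> progression l' d \<inter> set N = {}"
  proof -
    have "y ` {..<d} \<inter> y ` {d..<n} = y ` ({..<d} \<inter> {d..<n})"
      unfolding y_def by (rule inj_on_image_Int[OF fiber_point_inj, symmetric]) (use dk in auto)
    moreover have "{..<d} \<inter> {d..<n} = {}" by auto
    ultimately show ?thesis unfolding fiber_point_image[symmetric] N_def y_def by simp
  qed
  have "distinct L"
  proof -
    have "distinct (concat (map R [0..<d]))"
      by (rule distinct_concat_map_upt) (use R in \<open>auto simp: path_bundle_def\<close>)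
    moreover have "distinct N"
      unfolding N_def y_def distinct_map by (auto intro: inj_on_subset[OF fiber_point_inj])
    moreover have "set (concat (map R [0..<d])) \<inter> set N = {}"
      unfolding setR using RN Nw wW unfolding setF using w(2) by blast
    moreover have "set (concat (map R [0..<d])) \<inter> set M = {}"
      unfolding setR setM(1) using wW u(2) by blast
    moreover have "set N \<inter> set M = {}" using Nw setM wW by blast
    ultimately show ?thesis using setM(2) unfolding L_def by auto
  qed
  then have "distinct (A' @ N @ B' @ M)" using msetL mset_eq_imp_distinct_iff by blast
  moreover have "set (A' @ N @ B' @ M) = (W \<union> set Q) \<times> Z"
  proof -
    have "set (A' @ N @ B' @ M) = set L" using msetL mset_eq_setD by blast
    also have "\<dots> = (set F \<union> (set Q - {u, w}) \<times> Z \<union> {w} \<times> progression l' d) \<union> (set N \<union> (W \<times> Z - set F))"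
      unfolding L_def set_append setR setM(1) ..
    also have "\<dots> = W \<times> Z \<union> (set Q - {u, w}) \<times> Z \<union> ({w} \<times> progression l' d \<union> set N)"
    proof -
      have "set F \<subseteq> W \<times> Z" using dC(2) unfolding CFG by auto
      then show ?thesis by blast
    qed
    also have "\<dots> = (W \<union> set Q) \<times> Z" unfolding yfull using wQ wW by blast
    finally show ?thesis .
  qed
  moreover have "\<exists>b A B. A' @ N @ B' @ M = A @ map (fiber_point v b) [0..<n - joint_weight n \<sigma> (insert Q S) v] @ B"
    if v: "v \<in> (W \<union> set Q) \<inter> joints \<Q>" for v
  proof -
    consider "v = w" | "v = u" | "v \<in> W" "v \<notin> endpoints Q"
      using v joint_endpoint[OF Q(1), of v] w by blast
    then show ?thesis
    proof cases
      case 1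
      \<comment> \<open>\<open>w\<close> lies outside \<open>W\<close>, so no path of
        \<open>S\<close> can end there.\<close>
      have "joint_weight n \<sigma> S w = 0"
      proof -
        have none: "{Q' \<in> S. w \<in> endpoints Q'} = {}" using S endpoints_subset wW by blast
        show ?thesis unfolding joint_weight_def none by simp
      qed
      then have "joint_weight n \<sigma> (insert Q S) v = d"
        using joint_weight_insert[OF S(1) Q(2), of w] w 1 by (simp add: d_def)
      then show ?thesis unfolding N_def y_def fiber_point_shift[of w l' d n] 1 by auto
    next
      case 2
      then have "n - joint_weight n \<sigma> (insert Q S) v = k - d"
        using joint_weight_insert[OF S(1) Q(2), of u] u(1) by (simp add: d_def k_def)
      moreover have "A' @ N @ B' @ M = (A' @ N @ B') @ map (fiber_point u (b + int d * r)) [0..<k - d] @ (B @ A)"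
        unfolding M_def G_def x_def fiber_point_shift[of u b d k] by simp
      ultimately show ?thesis unfolding 2 by metis
    next
      case 3
      then have jw: "joint_weight n \<sigma> (insert Q S) v = joint_weight n \<sigma> S v"
        using joint_weight_insert[OF S(1) Q(2), of v] by simp
      obtain b1 A1 B1 where C1: "C = A1 @ map (fiber_point v b1) [0..<n - joint_weight n \<sigma> S v] @ B1"
        using C 3 v unfolding tour_def by blast
      \<comment> \<open>The grouping matches \<open>contiguous_after_rotation\<close> with
        \<open>G @ B\<close> behind \<open>F\<close>, so that the rotated word is
        \<open>M\<close>.\<close>
      have "A @ F @ (G @ B) = A1 @ map (fiber_point v b1) [0..<n - joint_weight n \<sigma> S v] @ B1"
        using C1 CFG by simp
      moreover have "F \<noteq> []" using s by (simp add: F_def)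
      moreover have "set F \<inter> set (map (fiber_point v b1) [0..<n - joint_weight n \<sigma> S v]) = {}"
        using 3 u(1) by (auto simp: setF fiber_point_def)
      ultimately obtain p q where "(G @ B) @ A = p @ map (fiber_point v b1) [0..<n - joint_weight n \<sigma> S v] @ q"
        using contiguous_after_rotation by blast
      then have "A' @ N @ B' @ M = (A' @ N @ B' @ p) @ map (fiber_point v b1) [0..<n - joint_weight n \<sigma> S v] @ q"
        by (simp add: M_def)
      then show ?thesis unfolding jw by blast
    qed
  qed
  ultimately show ?thesis using C' unfolding tour_def by blast
qed

text \<open>Induction on the number of vertices outside \<open>W\<close>. As every vertex of
  \<open>W\<close> is a joint or lies on a path of \<open>S\<close>, a path leaving \<open>W\<close>
  meets it only in endpoints; as \<open>W\<close> is connected through \<open>S\<close>,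
  \<open>acyclic_attachment\<close> excludes that both endpoints lie in \<open>W\<close>. So
  \<open>tour_extend\<close> applies.\<close>

lemma tour_completion:
  assumes "v0 \<in> W" "W \<subseteq> verts T" "S \<subseteq> \<Q>" "\<And>Q. Q \<in> S \<Longrightarrow> set Q \<subseteq> W"
    and "\<And>w. w \<in> W \<Longrightarrow> (linked S)\<^sup>*\<^sup>* v0 w" "\<And>w. w \<in> W \<Longrightarrow> w \<in> joints \<Q> \<or> (\<exists>Q\<in>S. w \<in> set Q)"
    and "tour S W C"
  shows "\<exists>S C. tour S (verts T) C"
  using assms
proof (induction "card (verts T - W)" arbitrary: W S C rule: less_induct)
  case less
  show ?case
  proof (cases "W = verts T")
    case True
    then show ?thesis using less.prems(7) by blast
  next
    case False
    then obtain Q u z where Q: "Q \<in> \<Q>" "u \<in> W" "u \<in> set Q" "z \<notin> W" "z \<in> set Q"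
      using frontier[of W] less.prems by blast
    then have "Q \<notin> S" using less.prems(4) by blast
    have ends: "a \<in> endpoints Q" if "a \<in> W" "a \<in> set Q" for a
      using less.prems(6)[OF that(1)] joint_endpoint[OF Q(1), of a] common_vertex_endpoint[OF Q(1), of _ a]
        less.prems(3) \<open>Q \<notin> S\<close> that(2) by blast
    have connected: "(linked S)\<^sup>*\<^sup>* a a'" if "a \<in> W" "a' \<in> W" for a a'
      using less.prems(5)[OF that(1)] less.prems(5)[OF that(2)] sympD[OF symp_rtranclp[OF symp_linked]]
      by (meson rtranclp_trans)
    have "W \<inter> set Q = {u}"
    proof (rule ccontr)
      assume "W \<inter> set Q \<noteq> {u}"
      then obtain a where "a \<in> W" "a \<in> set Q" "a \<noteq> u" using Q by blast
      then have "{a, u} = endpoints Q" using ends Q unfolding endpoints_def by blast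
      then have "hd Q \<in> W" "last Q \<in> W" using \<open>a \<in> W\<close> Q by (auto simp: endpoints_def doubleton_eq_iff)
      then show False using acyclic_attachment[OF less.prems(3) Q(1) \<open>Q \<notin> S\<close>] connected by blast
    qed
    then obtain C' where C': "tour (insert Q S) (W \<union> set Q) C'"
      using tour_extend[OF less.prems(7,3,4) Q(1) \<open>Q \<notin> S\<close> ends[OF Q(2,3)]] by blast
    have QT: "set Q \<subseteq> verts T" using path[OF Q(1)] by (simp add: is_path_def)
    show ?thesis
    proof (rule less.hyps[OF _ _ _ _ _ _ _ C'])
      have "finite (verts T)" using tree by (simp add: reflexive_tree_def finite_graph_def)
      moreover have "verts T - (W \<union> set Q) \<subset> verts T - W" using QT Q by blast
      ultimately show "card (verts T - (W \<union> set Q)) < card (verts T - W)" by (simp add: psubset_card_mono)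
    next
      fix a assume a: "a \<in> W \<union> set Q"
      have mono: "(linked S)\<^sup>*\<^sup>* v0 b \<Longrightarrow> (linked (insert Q S))\<^sup>*\<^sup>* v0 b" for b
        by (rule rtranclp_mono[THEN predicate2D]) (auto simp: linked_def)
      have "(linked (insert Q S))\<^sup>*\<^sup>* u a" if "a \<in> set Q"
        by (rule successively_imp_rtranclp[OF symp_linked linked_successively Q(3) that]) simp
      then show "(linked (insert Q S))\<^sup>*\<^sup>* v0 a"
        using a mono less.prems(5)[of a] less.prems(5)[OF Q(2)] by (meson UnE rtranclp_trans)
      show "a \<in> joints \<Q> \<or> (\<exists>Q'\<in>insert Q S. a \<in> set Q')"
        using a less.prems(6)[of a] by blast
    qed (use less.prems(1-4) QT Q in auto)
  qed
qed

lemma tour_single_fiber: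
  assumes "v \<in> joints \<Q>"
  shows "tour {} {v} (map (fiber_point v 0) [0..<n])"
proof -
  have "distinct (map (fiber_point v 0) [0..<n])"
    unfolding distinct_map using fiber_point_inj[of v 0] by (simp add: atLeast0LessThan)
  moreover have "closed_walk adj (map (fiber_point v 0) [0..<n])"
    using fiber_point_walk[OF assms, of 0] n by (simp add: closed_walk_def hd_map last_map)
  moreover have "set (map (fiber_point v 0) [0..<n]) = {v} \<times> Z"
    by (simp add: atLeast0LessThan fiber_point_image progression_full)
  moreover have "joint_weight n \<sigma> {} v = 0" by (simp add: joint_weight_def)
  then have "map (fiber_point v 0) [0..<n] = [] @ map (fiber_point v 0) [0..<n - joint_weight n \<sigma> {} v] @ []"
    by simp
  ultimately show ?thesis unfolding tour_def by blast
qed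

theorem hamiltonian_lift: "hamiltonian (lift_graph (integer_mod_group n) T \<sigma>)"
proof -
  obtain Q where Q: "Q \<in> \<Q>" using decomposition by (auto simp: odd_shifting_decomposition_def)
  define v where "v = hd Q"
  have v: "v \<in> endpoints Q" by (simp add: v_def endpoints_def)
  then have vj: "v \<in> joints \<Q>" using Q by (auto simp: joints_def)
  have ev: "endpoints Q \<subseteq> verts T" using endpoints_subset[OF Q] path[OF Q] by (auto simp: is_path_def)
  obtain S C where C: "tour S (verts T) C"
    using tour_completion[OF _ _ _ _ _ _ tour_single_fiber[OF vj], of v] v vj ev by auto
  obtain w where w: "endpoints Q = {v, w}" "v \<noteq> w" "0 < 2 * path_c n \<sigma> Q"
    using bundle_from_endpoint[OF odd_shifting[OF Q] v _ refl] endpoint_voltage Q by fastforce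
  \<comment> \<open>The weight bound at a single joint forces \<open>n \<ge> 2\<close>; with the two
    distinct ends of \<open>Q\<close> the lift has at least four vertices, so the closed walk is a
    genuine cycle.\<close>
  have "2 * path_c n \<sigma> Q \<le> joint_weight n \<sigma> {Q} v"
    using joint_weight_insert[of "{}" Q v] v by simp
  also have "\<dots> \<le> n" using joint_weight_le[of "{Q}" v] Q vj by simp
  finally have "2 \<le> n" using w(3) by simp
  have "3 \<le> length C"
  proof -
    have fin: "finite (verts T)" using tree by (simp add: reflexive_tree_def finite_graph_def)
    have "length C = card (verts T \<times> Z)" using C distinct_card unfolding tour_def by metis
    then have "length C = card (verts T) * n" by (simp add: card_cartesian_product)
    moreover have "2 \<le> card (verts T)"
      using card_mono[OF fin ev] w(2) unfolding w(1) by simp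
    ultimately show ?thesis using mult_le_mono[OF \<open>2 \<le> card (verts T)\<close> \<open>2 \<le> n\<close>] by simp
  qed
  moreover have "verts (lift_graph (integer_mod_group n) T \<sigma>) = verts T \<times> Z"
    using n by (simp add: lift_graph_def carrier_integer_mod_group)
  ultimately show ?thesis using C
    unfolding hamiltonian_def is_cycle_def is_path_conv_successively tour_def closed_walk_def by auto
qed

end

theorem theorem2:
  fixes n :: nat and T :: "'v ugraph" and \<sigma> :: "'v arc \<Rightarrow> int"
    and \<Q> :: "'v list set" and r :: int
  assumes "0 < n"
    and "reflexive_tree T"
    and "voltage_assignment (integer_mod_group n) T \<sigma>"
    and "odd_shifting_decomposition n T \<sigma> \<Q>"
    and "\<forall>Q\<in>\<Q>. \<forall>u\<in>endpoints Q. \<sigma> (Primary u) = r"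
    and "coprime r (int n)"
    and "properly_weighted n \<sigma> \<Q>"
  shows "hamiltonian (lift_graph (integer_mod_group n) T \<sigma>)"
proof -
  interpret decomposed_lift n T \<sigma> r \<Q>
    using assms by unfold_locales (auto simp: reflexive_tree_def)
  show ?thesis by (rule hamiltonian_lift)
qed

end
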